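(* The embeddability relation $\sqsubseteq_{Qdl}$ on the standard Borel space $X_{Qdl}$ of quandles with underlying set $\mathbb{N}$ is an invariantly universal $\boldsymbol{\Sigma}^1_1$ quasi-order: for every analytic quasi-order $R$ on a standard Borel space there is a Borel set $B\subseteq X_{Qdl}$ that is closed under isomorphism of quandles and such that $\sqsubseteq_{Qdl}\restriction B$ and $R$ are Borel bi-reducible.
   Context: A quandle is a set $Q$ with a binary operation $\ast$ such that $x\ast(y\ast z)=(x\ast y)\ast(x\ast z)$ for all $x,y,z$; for all $x,z$ there is a unique $y$ with $x\ast y=z$; and $x\ast x=x$ for all $x$. $X_{Qdl}$ is the set of quandle operations on $\mathbb{N}$, a $G_\delta$ subset of $2^{\mathbb{N}^3}$ (identifying an operation with its graph) with the induced Polish topology. $Q\sqsubseteq_{Qdl}Q'$ means there is an injective map $Q\to Q'$ preserving $\ast$. For quasi-orders $P$ on $X$ and $R$ on $Y$ (standard Borel spaces), $P$ Borel reduces to $R$ if there is a Borel $f\colon X\to Y$ with $x\mathrel{P}y\iff f(x)\mathrel{R}f(y)$; Borel bi-reducible means each Borel reduces to the other. $P\restriction B$ denotes the restriction $P\cap(B\times B)$. *)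

theory Defs
  imports "HOL-Analysis.Analysis"
begin

definition quandle :: "('a \<Rightarrow> 'a \<Rightarrow> 'a) \<Rightarrow> bool" where
  "quandle s \<longleftrightarrow>
     (\<forall>x y z. s x (s y z) = s (s x y) (s x z)) \<and>
     (\<forall>x z. \<exists>!y. s x y = z) \<and>
     (\<forall>x. s x x = x)"

definition quandle_hom :: "('a \<Rightarrow> 'a \<Rightarrow> 'a) \<Rightarrow> ('b \<Rightarrow> 'b \<Rightarrow> 'b) \<Rightarrow> ('a \<Rightarrow> 'b) \<Rightarrow> bool" where
  "quandle_hom s t h \<longleftrightarrow> (\<forall>x y. h (s x y) = t (h x) (h y))"

definition quandle_embeds :: "('a \<Rightarrow> 'a \<Rightarrow> 'a) \<Rightarrow> ('b \<Rightarrow> 'b \<Rightarrow> 'b) \<Rightarrow> bool" where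
  "quandle_embeds s t \<longleftrightarrow> (\<exists>h. inj h \<and> quandle_hom s t h)"

definition quandle_iso :: "('a \<Rightarrow> 'a \<Rightarrow> 'a) \<Rightarrow> ('b \<Rightarrow> 'b \<Rightarrow> 'b) \<Rightarrow> bool" where
  "quandle_iso s t \<longleftrightarrow> (\<exists>h. bij h \<and> quandle_hom s t h)"

definition op_graph :: "(nat \<Rightarrow> nat \<Rightarrow> nat) \<Rightarrow> (nat \<times> nat \<times> nat \<Rightarrow> bool)" where
  "op_graph s = (\<lambda>(x, y, z). s x y = z)"

lemma inj_op_graph: "inj op_graph"
  by (rule injI) (auto simp: op_graph_def fun_eq_iff)

definition X_Qdl :: "(nat \<times> nat \<times> nat \<Rightarrow> bool) set" where
  "X_Qdl = {op_graph s | s. quandle s}"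

text \<open>Here \<^term>\<open>borel\<close> is generated by the product topology on
  \<^typ>\<open>nat \<times> nat \<times> nat \<Rightarrow> bool\<close>, where \<^typ>\<open>bool\<close> is discrete.
  As in the other uses of \<^typ>\<open>'a measure\<close> below, only the underlying
  measurable space matters.\<close>

definition Qdl_space :: "(nat \<times> nat \<times> nat \<Rightarrow> bool) measure" where
  "Qdl_space = restrict_space borel X_Qdl"

definition Qdl_emb :: "(nat \<times> nat \<times> nat \<Rightarrow> bool) rel" where
  "Qdl_emb = {(op_graph s, op_graph t) | s t. quandle s \<and> quandle t \<and> quandle_embeds s t}"

definition Qdl_iso :: "(nat \<times> nat \<times> nat \<Rightarrow> bool) rel" where
  "Qdl_iso = {(op_graph s, op_graph t) | s t. quandle s \<and> quandle t \<and> quandle_iso s t}"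

definition standard_borel :: "'a measure \<Rightarrow> bool" where
  "standard_borel M \<longleftrightarrow>
     (\<exists>T. completely_metrizable_space T \<and> second_countable T \<and>
          space M = topspace T \<and> sets M = sigma_sets (topspace T) {U. openin T U})"

text \<open>Boldface \<open>\<Sigma>\<^sup>1\<^sub>1\<close>: projections of Borel subsets of the product with the
  Baire space \<^typ>\<open>nat \<Rightarrow> nat\<close>.\<close>

definition analytic_set :: "'a measure \<Rightarrow> 'a set \<Rightarrow> bool" where
  "analytic_set M A \<longleftrightarrow>
     (\<exists>C \<in> sets (M \<Otimes>\<^sub>M (borel :: (nat \<Rightarrow> nat) measure)). A = fst ` C)"

definition analytic_quasi_order :: "'a measure \<Rightarrow> 'a rel \<Rightarrow> bool" where
  "analytic_quasi_order M R \<longleftrightarrow> preorder_on (space M) R \<and> analytic_set (M \<Otimes>\<^sub>M M) R"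

definition borel_reducible :: "'a measure \<Rightarrow> 'a rel \<Rightarrow> 'b measure \<Rightarrow> 'b rel \<Rightarrow> bool" where
  "borel_reducible M P N R \<longleftrightarrow>
     (\<exists>f \<in> measurable M N. \<forall>x\<in>space M. \<forall>y\<in>space M. (x, y) \<in> P \<longleftrightarrow> (f x, f y) \<in> R)"

definition borel_bireducible :: "'a measure \<Rightarrow> 'a rel \<Rightarrow> 'b measure \<Rightarrow> 'b rel \<Rightarrow> bool" where
  "borel_bireducible M P N R \<longleftrightarrow> borel_reducible M P N R \<and> borel_reducible N R M P"

end

theory Submission
  imports Defs "HOL-Library.Sublist"
begin

text \<open>Code points of a standard Borel space by \<open>\<sigma> :: nat \<Rightarrow> bool\<close>. An analytic quasi-order then takes the form
  \<open>\<sigma> R \<tau>\<close> iff for some \<open>\<delta>\<close> all restrictions \<open>(\<sigma>|n, \<tau>|n, \<delta>|n)\<close> lie in a fixed set \<open>F\<close>. A node is a pair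
  \<open>(n, s)\<close> where the word \<open>s\<close> is a list of pairs \<open>(v, d)\<close>; it carries the label \<open>u\<close> in the structure of \<open>\<sigma>\<close>
  if \<open>s\<close> describes a chain of \<open>F\<close>-steps from \<open>u\<close> to \<open>\<sigma>|n\<close>. The rest of the structure (prepending words,
  truncating words to level \<open>n\<close>) does not depend on \<open>\<sigma>\<close>, is rigid, and is preserved by the right
  multiplications \<open>(n, s) \<mapsto> (n, s t\<^sub>n)\<close> with coherent words \<open>t\<^sub>n\<close>. Conversely an embedding yields coherent
  \<open>t\<^sub>n\<close> by sending the empty word of level \<open>n\<close> to \<open>(n, t\<^sub>n)\<close>, and preservation of labels says that \<open>t\<^sub>n\<close> is a chain from
  \<open>\<sigma>|n\<close> to \<open>\<tau>|n\<close>; in the limit, \<open>\<sigma>\<close> and \<open>\<tau>\<close> are connected by finitely many steps of \<open>R\<close>. Concatenation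
  of chains thus replaces the usual normal form for trees of analytic quasi-orders.

  The structure is turned into a quandle made of a copy of the integers over each node, together with
  actors that translate these copies by prescribed amounts and are otherwise inert. As the whole
  structure is definable, a copy of such a quandle has a canonical presentation, depending on it in a
  Borel way, from which \<open>\<sigma>\<close> can be read off. So the saturation is Borel without recourse to a theorem on
  injective Borel images.\<close>

section \<open>Finite restrictions of sequences and their limits\<close>

definition restr :: "nat \<Rightarrow> (nat \<Rightarrow> 'a) \<Rightarrow> 'a list" where
  "restr n f = map f [0..<n]"

lemma length_restr [simp]: "length (restr n f) = n"
  by (simp add: restr_def)

lemma nth_restr [simp]: "i < n \<Longrightarrow> restr n f ! i = f i"
  by (simp add: restr_def)

lemma take_restr: "m \<le> n \<Longrightarrow> take m (restr n f) = restr m f"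
  by (simp add: restr_def take_map)

lemma restr_eqD: "(\<And>n. restr n f = restr n g) \<Longrightarrow> f = g"
  by (metis ext lessI nth_restr)

text \<open>The list \<open>l (Suc i)\<close> is the first with an entry at \<open>i\<close>, and
  coherence keeps that entry in all later lists. This turns coherent words into points in the
  limit.\<close>

lemma restr_of_coherent:
  assumes "\<And>n. length (l n) = n" and "\<And>n. take n (l (Suc n)) = l n"
  shows "restr n (\<lambda>i. l (Suc i) ! i) = l n"
proof (induction n)
  case 0
  then show ?case using assms(1)[of 0] by (simp add: restr_def)
next
  case (Suc n)
  have "l (Suc n) = take n (l (Suc n)) @ [l (Suc n) ! n]"
    using assms(1)[of "Suc n"] by (metis lessI order_refl take_Suc_conv_app_nth take_all_iff)
  with Suc assms(2)[of n] show ?case by (simp add: restr_def)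
qed

subsection \<open>Quandles of words\<close>

type_synonym letter = "bool list \<times> nat list"
type_synonym node = "nat \<times> letter list"

text \<open>What a weight can record: \<open>Same n w\<close> that a node of level \<open>n\<close>
  arises from that of the actor by prepending \<open>w\<close>, \<open>Next n\<close> that a node of
  level \<open>Suc n\<close> truncates to that of the actor, \<open>Lab u\<close> that the node has
  label \<open>u\<close>.\<close>

datatype code = Same nat "letter list" | Next nat | Lab "bool list"
instance code :: countable by countable_datatype

text \<open>\<open>Fib v j\<close> is the point \<open>j\<close> of the integer line over
  \<open>v\<close>. \<open>Lbl v u\<close> exists whether or not \<open>u\<close> labels
  \<open>v\<close>, so that the carrier is independent of the coded point. The two points
  \<open>Flip b\<close> serve to single out \<open>Hub\<close>.\<close>

datatype elem = Hub | Flip bool | Act node | Lbl node "bool list" | Fib node int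
instance elem :: countable by countable_datatype

definition proj :: "nat \<Rightarrow> letter list \<Rightarrow> letter list" where
  "proj n = map (map_prod (take n) (take n))"

text \<open>The offset keeps these weights apart from the weight 1 of \<open>Hub\<close>.\<close>

definition wt :: "code \<Rightarrow> nat" where
  "wt c = Suc (Suc (to_nat c))"

lemma wt_inject [simp]: "wt c = wt c' \<longleftrightarrow> c = c'"
  by (simp add: wt_def)

lemma wt_simps [simp]: "wt c \<noteq> 0" "wt c \<noteq> Suc 0" "0 \<noteq> wt c" "Suc 0 \<noteq> wt c" "wt c > 0"
  by (auto simp: wt_def)

locale word_coding =
  fixes F :: "bool list \<Rightarrow> bool list \<Rightarrow> nat list \<Rightarrow> bool"
  assumes F_length: "F u v d \<Longrightarrow> length u = length v \<and> length d = length v"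
begin

fun chain :: "bool list \<Rightarrow> letter list \<Rightarrow> bool list \<Rightarrow> bool" where
  "chain u [] w \<longleftrightarrow> u = w"
| "chain u ((v, d) # s) w \<longleftrightarrow> F u v d \<and> chain v s w"

lemma chain_append: "chain u (s @ t) w \<longleftrightarrow> (\<exists>v. chain u s v \<and> chain v t w)"
  by (induction u s w rule: chain.induct) auto

text \<open>The chain runs from the label to the restriction of \<sigma>, so appending a chain from
  there to the restriction of \<tau> keeps the label.\<close>

definition labelled :: "(nat \<Rightarrow> bool) \<Rightarrow> node \<Rightarrow> bool list \<Rightarrow> bool" where
  "labelled \<sigma> v u \<longleftrightarrow> length u = fst v \<and> chain u (snd v) (restr (fst v) \<sigma>)"

text \<open>In the clause for \<open>Same\<close> the \<open>take\<close> extracts the word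
  \<open>w\<close> with \<open>s' = w @ s\<close>. Only the weights of \<open>Lbl\<close> depend on
  \<sigma>.\<close>

fun weight :: "(nat \<Rightarrow> bool) \<Rightarrow> elem \<Rightarrow> node \<Rightarrow> nat" where
  "weight \<sigma> Hub v = 1"
| "weight \<sigma> (Act (n, s)) (m, s') =
     (if m = n \<and> suffix s s' then wt (Same n (take (length s' - length s) s'))
      else if m = Suc n \<and> proj n s' = s then wt (Next n) else 0)"
| "weight \<sigma> (Lbl v u) v' = (if v = v' \<and> labelled \<sigma> v u then wt (Lab u) else 0)"
| "weight \<sigma> (Flip b) v = 0"
| "weight \<sigma> (Fib v' j) v = 0"

text \<open>\<open>wt\<close> is injective and avoids 0 and 1, so a single weight reveals the kind
  of actor and how its node lies relative to the fibre.\<close>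

lemma weight_Same_iff:
  "weight \<sigma> a v = wt (Same n w) \<longleftrightarrow> (\<exists>s. a = Act (n, s) \<and> v = (n, w @ s))"
  by (cases "(\<sigma>, a, v)" rule: weight.cases) (auto simp: suffix_def)

lemma weight_Next_iff:
  "weight \<sigma> a v = wt (Next n) \<longleftrightarrow> (\<exists>s. a = Act (n, proj n s) \<and> v = (Suc n, s))"
  by (cases "(\<sigma>, a, v)" rule: weight.cases) auto

lemma weight_Lab_iff:
  "weight \<sigma> a v = wt (Lab u) \<longleftrightarrow> a = Lbl v u \<and> labelled \<sigma> v u"
  by (cases "(\<sigma>, a, v)" rule: weight.cases) auto

definition qop :: "(nat \<Rightarrow> bool) \<Rightarrow> elem \<Rightarrow> elem \<Rightarrow> elem" where
  "qop \<sigma> a e = (case e of Fib v j \<Rightarrow> Fib v (j + int (weight \<sigma> a v))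
                 | Flip b \<Rightarrow> Flip (b \<noteq> (a = Hub)) | _ \<Rightarrow> e)"

lemma qop_simps [simp]:
  "qop \<sigma> a (Fib v j) = Fib v (j + int (weight \<sigma> a v))"
  "qop \<sigma> a (Flip b) = Flip (b \<noteq> (a = Hub))"
  "qop \<sigma> a Hub = Hub" "qop \<sigma> a (Act v) = Act v" "qop \<sigma> a (Lbl v u) = Lbl v u"
  by (auto simp: qop_def)

text \<open>The left translations commute, being shifts of lines and powers of one flip, and
  \<open>qop \<sigma> x y\<close> acts exactly as \<open>y\<close> does, since only elements that
  act trivially are ever moved.\<close>

lemma quandle_qop: "quandle (qop \<sigma>)"
proof -
  have "qop \<sigma> x (qop \<sigma> y z) = qop \<sigma> (qop \<sigma> x y) (qop \<sigma> x z)" for x y z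
    by (cases x; cases y; cases z) auto
  moreover have "\<exists>!y. qop \<sigma> x y = z" for x z
  proof
    let ?y = "case z of Fib v j \<Rightarrow> Fib v (j - int (weight \<sigma> x v)) | _ \<Rightarrow> qop \<sigma> x z"
    show "qop \<sigma> x ?y = z" by (cases z) auto
    show "y = ?y" if "qop \<sigma> x y = z" for y using that by (cases y; cases z) auto
  qed
  moreover have "qop \<sigma> x x = x" for x by (cases x) auto
  ultimately show ?thesis unfolding quandle_def by blast
qed

section \<open>From embeddings to coherent chains\<close>

lemma qop_Hub_funpow: "(qop \<sigma> Hub ^^ k) (Fib v j) = Fib v (j + int k)"
  by (induction k) auto

text \<open>A translation of an integer line has no cycle of length 2, so only the swap of the two
  flips by \<open>Hub\<close> remains.\<close>

lemma qop_2cycle_iff: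
  "qop \<sigma> a p \<noteq> p \<and> qop \<sigma> a (qop \<sigma> a p) = p \<longleftrightarrow> a = Hub \<and> (\<exists>b. p = Flip b)"
  by (cases p) auto

lemma qop_moved_iff:
  "qop \<sigma> Hub p \<noteq> p \<and> qop \<sigma> Hub (qop \<sigma> Hub p) \<noteq> p \<longleftrightarrow> (\<exists>v j. p = Fib v j)"
  by (cases p) auto

text \<open>The 2-cycle of \<open>Hub\<close> forces an embedding to fix \<open>Hub\<close>; so it commutes with the unit shift
  of the fibres and can neither merge fibres nor rescale weights.\<close>

lemma embedding_weight:
  assumes "inj h" and "quandle_hom (qop \<sigma>) (qop \<tau>) h"
  shows "\<exists>w. \<forall>a. weight \<tau> (h a) w = weight \<sigma> a v"
proof -
  have hom: "h (qop \<sigma> x y) = qop \<tau> (h x) (h y)" for x y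
    using assms(2) by (simp add: quandle_hom_def)
  have "qop \<tau> (h Hub) (h (Flip False)) \<noteq> h (Flip False) \<and>
        qop \<tau> (h Hub) (qop \<tau> (h Hub) (h (Flip False))) = h (Flip False)"
    unfolding hom[symmetric] by (simp add: inj_eq[OF assms(1)])
  then have Hub: "h Hub = Hub" by (simp add: qop_2cycle_iff)
  have "qop \<tau> Hub (h e) = h (qop \<sigma> Hub e)" for e
    by (simp add: hom Hub)
  then have "qop \<tau> Hub (h (Fib v 0)) \<noteq> h (Fib v 0) \<and> qop \<tau> Hub (qop \<tau> Hub (h (Fib v 0))) \<noteq> h (Fib v 0)"
    by (simp add: inj_eq[OF assms(1)])
  then obtain w i where w: "h (Fib v 0) = Fib w i" by (auto simp: qop_moved_iff)
  \<comment> \<open>The image of position 0 determines those of all positions \<open>int k\<close>,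
    because \<open>h\<close> commutes with the unit shift. Weights are naturals, so they take
    \<open>Fib v 0\<close> only to such positions.\<close>
  have shift: "h (Fib v (int k)) = Fib w (i + int k)" for k
  proof (induction k)
    case (Suc k)
    have "h (Fib v (int (Suc k))) = qop \<tau> (h Hub) (h (Fib v (int k)))"
      unfolding hom[symmetric] by (simp add: add.commute)
    then show ?case using Suc Hub by (simp add: add.commute)
  qed (simp add: w)
  have "weight \<tau> (h a) w = weight \<sigma> a v" for a
  proof -
    have "h (Fib v (int (weight \<sigma> a v))) = qop \<tau> (h a) (h (Fib v 0))"
      unfolding hom[symmetric] by simp
    then show ?thesis by (simp add: w shift)
  qed
  then show ?thesis by blast
qed

lemma embedding_chain:
  assumes "inj h" and "quandle_hom (qop \<sigma>) (qop \<tau>) h"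
  obtains t where "\<And>n. proj n (t (Suc n)) = t n" "\<And>n. chain (restr n \<sigma>) (t n) (restr n \<tau>)"
proof -
  obtain \<phi> where \<phi>: "\<And>a v. weight \<tau> (h a) (\<phi> v) = weight \<sigma> a v"
    using embedding_weight[OF assms] by metis
  \<comment> \<open>The weight \<open>wt (Same n [])\<close> occurs only between an actor and its
    own node, so both images carry the same word, which becomes \<open>t n\<close>.\<close>
  have "\<exists>s. h (Act (n, [])) = Act (n, s) \<and> \<phi> (n, []) = (n, s)" for n
    using \<phi>[of "Act (n, [])" "(n, [])"] weight_Same_iff[of \<tau> "h (Act (n, []))" "\<phi> (n, [])" n "[]"] by auto
  then obtain t where t: "\<And>n. h (Act (n, [])) = Act (n, t n)" "\<And>n. \<phi> (n, []) = (n, t n)"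
    by metis
  \<comment> \<open>The empty word of level \<open>Suc n\<close> truncates to that of level
    \<open>n\<close>; preservation of this weight makes the words coherent.\<close>
  have next_t: "weight \<tau> (Act (n, t n)) (Suc n, t (Suc n)) = wt (Next n)" for n
    using \<phi>[of "Act (n, [])" "(Suc n, [])"] unfolding t by (simp add: proj_def)
  have "proj n (t (Suc n)) = t n" for n
    using next_t[of n] unfolding weight_Next_iff by auto
  moreover have "chain (restr n \<sigma>) (t n) (restr n \<tau>)" for n
  proof -
    \<comment> \<open>\<open>restr n \<sigma>\<close> labels the empty word of level
      \<open>n\<close> through the empty chain.\<close>
    have "weight \<tau> (h (Lbl (n, []) (restr n \<sigma>))) (n, t n) = wt (Lab (restr n \<sigma>))"
      using \<phi>[of "Lbl (n, []) (restr n \<sigma>)" "(n, [])"] unfolding t by (simp add: labelled_def)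
    then show ?thesis unfolding weight_Lab_iff by (simp add: labelled_def)
  qed
  ultimately show thesis by (rule that)
qed

section \<open>From coherent chains to embeddings\<close>

definition live :: "(nat \<Rightarrow> bool) \<Rightarrow> elem \<Rightarrow> bool" where
  "live \<sigma> e \<longleftrightarrow> (case e of Lbl v u \<Rightarrow> labelled \<sigma> v u | _ \<Rightarrow> True)"

lemma live_simps [simp]:
  "live \<sigma> Hub" "live \<sigma> (Flip b)" "live \<sigma> (Act v)" "live \<sigma> (Fib v j)"
  "live \<sigma> (Lbl v u) \<longleftrightarrow> labelled \<sigma> v u"
  by (auto simp: live_def)

lemma not_live: "\<not> live \<sigma> e \<Longrightarrow> weight \<sigma> e v = 0" "\<not> live \<sigma> e \<Longrightarrow> e \<noteq> Hub"
  "\<not> live \<sigma> e \<Longrightarrow> qop \<sigma> a e = e" "\<not> live \<sigma> a \<Longrightarrow> qop \<sigma> a e = e"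
   apply (cases e; simp)
   apply auto[1]
   apply (cases e; simp)
  apply (cases a; cases e; simp)
  done

lemma live_qop [simp]: "live \<sigma> (qop \<sigma> a e) = live \<sigma> e"
  by (cases e) auto

text \<open>At level 0 every nonempty list is an impossible label. Having infinitely many dead
  elements makes the inert parts of any two word quandles equinumerous.\<close>

lemma infinite_not_live: "infinite {e. \<not> live \<sigma> e}"
proof
  assume "finite {e. \<not> live \<sigma> e}"
  moreover have "(\<lambda>k. Lbl (0, []) (replicate (Suc k) True)) ` UNIV \<subseteq> {e. \<not> live \<sigma> e}"
    by (auto simp: labelled_def)
  ultimately have "finite ((\<lambda>k. Lbl (0, []) (replicate (Suc k) True)) ` UNIV)"
    by (rule finite_subset[rotated])
  moreover have "inj (\<lambda>k. Lbl (0, []) (replicate (Suc k) True))"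
    by (rule injI) (metis Suc_inject elem.inject(3) length_replicate)
  ultimately show False using finite_imageD by blast
qed

lemma countable_infinite_bij:
  fixes A :: "'b set" and B :: "'c set"
  assumes "countable A" "infinite A" "countable B" "infinite B"
  shows "\<exists>f. bij_betw f A B"
proof -
  from assms obtain f :: "'b \<Rightarrow> nat" and g :: "'c \<Rightarrow> nat"
    where "bij_betw f A UNIV" "bij_betw g B UNIV"
    by (metis countableE_infinite)
  then show ?thesis using bij_betw_trans bij_betw_inv_into by blast
qed

lemma embedding_of_chains:
  assumes proj: "\<And>n. proj n (t (Suc n)) = t n"
    and chain: "\<And>n. chain (restr n \<sigma>) (t n) (restr n \<tau>)"
  shows "quandle_embeds (qop \<sigma>) (qop \<tau>)"
proof -
  obtain f where f: "bij_betw f {e. \<not> live \<sigma> e} {e. \<not> live \<tau> e}"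
    using countable_infinite_bij[OF _ infinite_not_live _ infinite_not_live] by blast
  define tr :: "node \<Rightarrow> node" where "tr v = (fst v, snd v @ t (fst v))" for v
  \<comment> \<open>A list that is no label of \<open>v\<close> for \<sigma> may be a label of
    \<open>tr v\<close> for \<tau>. Moving it along \<open>tr\<close> would create a new weight, so
    dead elements are matched with dead ones by \<open>f\<close> instead.\<close>
  define h where "h e = (if live \<sigma> e then
     (case e of Act v \<Rightarrow> Act (tr v) | Lbl v u \<Rightarrow> Lbl (tr v) u | Fib v j \<Rightarrow> Fib (tr v) j | _ \<Rightarrow> e)
     else f e)" for e
  have tr_inj: "tr v = tr w \<longleftrightarrow> v = w" for v w
    by (auto simp: tr_def prod_eq_iff)
  have h_Act: "h (Act v) = Act (tr v)" and h_Fib: "h (Fib v j) = Fib (tr v) j"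
    and h_Lbl: "labelled \<sigma> v u \<Longrightarrow> h (Lbl v u) = Lbl (tr v) u"
    and h_f: "\<not> live \<sigma> e \<Longrightarrow> h e = f e" and h_Hub: "h Hub = Hub" and h_Flip: "h (Flip b) = Flip b"
    for v j u e b
    by (auto simp: h_def)
  have lab: "labelled \<sigma> v u \<Longrightarrow> labelled \<tau> (tr v) u" for v u
    using chain by (auto simp: labelled_def tr_def chain_append)
  have live_h: "live \<sigma> e \<longleftrightarrow> live \<tau> (h e)" for e
  proof (cases "live \<sigma> e")
    case True
    then show ?thesis by (cases e) (auto simp: h_Act h_Fib h_Lbl h_Hub h_Flip lab)
  next
    case False
    then show ?thesis using bij_betwE[OF f] by (auto simp: h_f)
  qed
  have "inj h"
  proof (rule injI)
    fix e e' assume eq: "h e = h e'"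
    then have "live \<sigma> e = live \<sigma> e'" by (simp add: live_h)
    then consider "live \<sigma> e" "live \<sigma> e'" | "\<not> live \<sigma> e" "\<not> live \<sigma> e'" by blast
    then show "e = e'"
    proof cases
      case 1
      with eq show ?thesis
        by (cases e; cases e') (auto simp: h_Act h_Fib h_Lbl h_Hub h_Flip tr_inj)
    next
      case 2
      with eq show ?thesis
        using inj_onD[OF bij_betw_imp_inj_on[OF f], of e e'] by (simp add: h_f)
    qed
  qed
  moreover have wgt: "weight \<tau> (h a) (tr v) = weight \<sigma> a v" for a v
  proof (cases "live \<sigma> a")
    case False
    then have "\<not> live \<tau> (h a)" by (simp add: live_h)
    with False show ?thesis by (simp add: not_live)
  next
    case True
    show ?thesis
    proof (cases a)
      case (Act w)
      obtain n s m s' where w: "w = (n, s)" and v: "v = (m, s')" by (cases w; cases v)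
      \<comment> \<open>Appending on the right commutes with prepending, and \<open>proj\<close>
        distributes over appending, so coherence of \<open>t\<close> takes care of
        \<open>Next\<close>.\<close>
      show ?thesis
        using proj[of n] unfolding Act h_Act unfolding w v tr_def
        by (auto simp: proj_def suffix_def)
    qed (use True in \<open>auto simp: h_Fib h_Lbl h_Hub h_Flip tr_inj lab\<close>)
  qed
  have "quandle_hom (qop \<sigma>) (qop \<tau>) h"
    unfolding quandle_hom_def
  proof (intro allI)
    fix x y
    show "h (qop \<sigma> x y) = qop \<tau> (h x) (h y)"
    proof (cases "live \<sigma> y")
      case False
      then show ?thesis using live_h by (simp add: not_live)
    next
      case True
      have "x = Hub \<longleftrightarrow> h x = Hub"
        using \<open>inj h\<close> h_Hub by (metis injD)
      with True show ?thesis
        by (cases y) (auto simp: h_Act h_Fib h_Lbl h_Hub h_Flip wgt)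
    qed
  qed
  ultimately show ?thesis unfolding quandle_embeds_def by blast
qed

section \<open>The coded relation and limits of chains\<close>

definition rel :: "(nat \<Rightarrow> bool) \<Rightarrow> (nat \<Rightarrow> bool) \<Rightarrow> bool" where
  "rel \<sigma> \<tau> \<longleftrightarrow> (\<exists>\<delta>. \<forall>n. F (restr n \<sigma>) (restr n \<tau>) (restr n \<delta>))"

lemma embeds_of_rel:
  assumes "rel \<sigma> \<tau>"
  shows "quandle_embeds (qop \<sigma>) (qop \<tau>)"
proof -
  obtain \<delta> where \<delta>: "\<And>n. F (restr n \<sigma>) (restr n \<tau>) (restr n \<delta>)"
    using assms by (auto simp: rel_def)
  show ?thesis
    \<comment> \<open>One-letter words: a step of \<open>rel\<close> is a chain of length 1 at every
      level.\<close>
    by (rule embedding_of_chains[of "\<lambda>n. [(restr n \<tau>, restr n \<delta>)]"])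
      (auto simp: proj_def take_restr \<delta>)
qed

text \<open>Truncation keeps the number of letters, so all \<open>t n\<close> have the same length,
  on which the induction runs. The first letters converge to an intermediate point and a witness for
  one step of \<open>rel\<close>; the remaining words are coherent chains from that point.\<close>

lemma chain_limit:
  assumes "\<And>n. proj n (t (Suc n)) = t n" and "\<And>n. chain (restr n \<sigma>) (t n) (restr n \<tau>)"
  shows "rel\<^sup>*\<^sup>* \<sigma> \<tau>"
  using assms
proof (induction "length (t 0)" arbitrary: \<sigma> t)
  have len: "length (t n) = length (t 0)" if "\<And>n. proj n (t (Suc n)) = t n"
    for n and t :: "nat \<Rightarrow> letter list"
  proof (induction n)
    case (Suc n)
    then show ?case using arg_cong[OF that[of n], of length] by (simp add: proj_def)
  qed simp
  { case 0
    then have "t n = []" for n using len[of t n] by simp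
    with 0 have "\<sigma> = \<tau>" by (intro restr_eqD) simp
    then show ?case by simp
  next
    case (Suc k)
    then have "\<exists>v d s. t n = (v, d) # s" for n
      using len[of t n] by (cases "t n") auto
    then obtain v d s where t: "\<And>n. t n = (v n, d n) # s n" by metis
    have c: "F (restr n \<sigma>) (v n) (d n)" "chain (v n) (s n) (restr n \<tau>)" for n
      using Suc.prems(2)[of n] by (auto simp: t)
    have p: "take n (v (Suc n)) = v n" "take n (d (Suc n)) = d n" "proj n (s (Suc n)) = s n" for n
      using Suc.prems(1)[of n] by (auto simp: t proj_def)
    have l: "length (v n) = n" "length (d n) = n" for n
      using F_length[OF c(1)[of n]] by auto
    define \<rho> where "\<rho> i = v (Suc i) ! i" for i
    define \<delta> where "\<delta> i = d (Suc i) ! i" for i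
    have \<rho>: "restr n \<rho> = v n" for n
      unfolding \<rho>_def using l p by (intro restr_of_coherent) auto
    have \<delta>: "restr n \<delta> = d n" for n
      unfolding \<delta>_def using l p by (intro restr_of_coherent) auto
    have "rel \<sigma> \<rho>" unfolding rel_def using c(1) \<rho> \<delta> by metis
    moreover have "rel\<^sup>*\<^sup>* \<rho> \<tau>"
      using Suc.hyps(2) by (intro Suc.hyps(1)[of s]) (auto simp: t p c(2) \<rho>)
    ultimately show ?case by simp }
qed

lemma rtrancl_rel_of_embeds:
  assumes "quandle_embeds (qop \<sigma>) (qop \<tau>)"
  shows "rel\<^sup>*\<^sup>* \<sigma> \<tau>"
  using assms chain_limit embedding_chain unfolding quandle_embeds_def by metis

end

subsection \<open>Canonical presentation\<close>

text \<open>This and the following notions are formulated in the operation alone, so isomorphisms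
  preserve them. On the natural numbers all their quantifiers are countable, which makes them
  Borel.\<close>

definition hubs :: "('a \<Rightarrow> 'a \<Rightarrow> 'a) \<Rightarrow> 'a \<Rightarrow> bool" where
  "hubs g c \<longleftrightarrow> (\<exists>p. g c p \<noteq> p \<and> g c (g c p) = p)"

definition flips :: "('a \<Rightarrow> 'a \<Rightarrow> 'a) \<Rightarrow> 'a \<Rightarrow> bool" where
  "flips g p \<longleftrightarrow> (\<exists>c. g c p \<noteq> p \<and> g c (g c p) = p)"

text \<open>The hub supplies the unit of length; that it does not return \<open>y\<close> after two
  steps excludes the flips.\<close>

definition moves :: "('a \<Rightarrow> 'a \<Rightarrow> 'a) \<Rightarrow> nat \<Rightarrow> 'a \<Rightarrow> 'a \<Rightarrow> bool" where
  "moves g k a y \<longleftrightarrow> (\<exists>c. hubs g c \<and> g c y \<noteq> y \<and> g c (g c y) \<noteq> y \<and> g a y = (g c ^^ k) y)"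

text \<open>Describes the fibre over the empty word: a point over \<open>(n, s)\<close> with
  \<open>s\<close> nonempty is shifted by \<open>wt (Same n s)\<close> under the actor of the empty
  word.\<close>

definition origin :: "('a \<Rightarrow> 'a \<Rightarrow> 'a) \<Rightarrow> nat \<Rightarrow> 'a \<Rightarrow> bool" where
  "origin g n y \<longleftrightarrow> (\<exists>a. moves g (wt (Same n [])) a y) \<and>
     (\<forall>a w. w \<noteq> [] \<longrightarrow> \<not> moves g (wt (Same n w)) a y)"

text \<open>The weight over an origin \<open>z\<close> pins down \<open>a\<close> as the actor of
  the empty word; its weight over \<open>y\<close> then spells out the word of
  \<open>y\<close>.\<close>

definition fibre :: "('a \<Rightarrow> 'a \<Rightarrow> 'a) \<Rightarrow> node \<Rightarrow> 'a \<Rightarrow> bool" where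
  "fibre g v y \<longleftrightarrow> (\<exists>a z. origin g (fst v) z \<and> moves g (wt (Same (fst v) [])) a z \<and>
     moves g (wt (Same (fst v) (snd v))) a y)"

definition actor :: "('a \<Rightarrow> 'a \<Rightarrow> 'a) \<Rightarrow> node \<Rightarrow> code \<Rightarrow> 'a \<Rightarrow> bool" where
  "actor g v k a \<longleftrightarrow> (\<exists>y. fibre g v y \<and> moves g (wt k) a y)"

definition inert :: "('a \<Rightarrow> 'a \<Rightarrow> 'a) \<Rightarrow> 'a \<Rightarrow> bool" where
  "inert g y \<longleftrightarrow> (\<forall>z. g y z = z \<and> g z y = y)"

text \<open>In the word quandle of \<sigma> the empty word of level \<open>Suc i\<close> has the
  single label \<open>restr (Suc i) \<sigma>\<close>, the shortest restriction with an entry at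
  \<open>i\<close>.\<close>

definition decode :: "('a \<Rightarrow> 'a \<Rightarrow> 'a) \<Rightarrow> nat \<Rightarrow> bool" where
  "decode g i \<longleftrightarrow> (\<exists>u a. actor g (Suc i, []) (Lab u) a \<and> u ! i)"

text \<open>One of the two exponents is 0, so this expresses a shift by any integer \<open>j\<close>
  without the inverse of the hub.\<close>

definition shifted :: "('a \<Rightarrow> 'a \<Rightarrow> 'a) \<Rightarrow> int \<Rightarrow> 'a \<Rightarrow> 'a \<Rightarrow> bool" where
  "shifted g j z y \<longleftrightarrow> (\<exists>c. hubs g c \<and> (g c ^^ nat (- j)) y = (g c ^^ nat j) z)"

section \<open>Invariance of the definable notions under isomorphism\<close>

lemma bij_ex: "bij \<theta> \<Longrightarrow> (\<exists>y. P y) \<longleftrightarrow> (\<exists>x. P (\<theta> x))"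
  by (metis bij_pointE)

lemma bij_all: "bij \<theta> \<Longrightarrow> (\<forall>y. P y) \<longleftrightarrow> (\<forall>x. P (\<theta> x))"
  by (metis bij_pointE)

context
  fixes f :: "'a \<Rightarrow> 'a \<Rightarrow> 'a" and g :: "'b \<Rightarrow> 'b \<Rightarrow> 'b" and \<theta>
  assumes bij: "bij \<theta>" and hom: "quandle_hom f g \<theta>"
begin

lemma transport_op: "g (\<theta> x) (\<theta> y) = \<theta> (f x y)"
  using hom by (simp add: quandle_hom_def)

lemma transport_eq: "\<theta> x = \<theta> y \<longleftrightarrow> x = y"
  using bij by (simp add: bij_is_inj inj_eq)

lemma transport_funpow: "(g (\<theta> x) ^^ k) (\<theta> y) = \<theta> ((f x ^^ k) y)"
  by (induction k) (auto simp: transport_op)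

lemma transport_hubs: "hubs g (\<theta> c) = hubs f c"
  unfolding hubs_def bij_ex[OF bij, where P="\<lambda>p. g _ p \<noteq> p \<and> _ p"] by (simp add: transport_op transport_eq)

lemma transport_flips: "flips g (\<theta> p) = flips f p"
  unfolding flips_def bij_ex[OF bij, where P="\<lambda>c. g c _ \<noteq> _ \<and> _ c"] by (simp add: transport_op transport_eq)

lemma transport_moves: "moves g k (\<theta> a) (\<theta> y) = moves f k a y"
  unfolding moves_def bij_ex[OF bij, where P="\<lambda>c. hubs g c \<and> _ c"]
  by (simp add: transport_op transport_eq transport_hubs transport_funpow)

lemma transport_origin: "origin g n (\<theta> y) = origin f n y"
  unfolding origin_def bij_ex[OF bij, where P="\<lambda>a. moves g _ a _"]
    bij_all[OF bij, where P="\<lambda>a. \<forall>w. w \<noteq> [] \<longrightarrow> _ a w"]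
  by (simp add: transport_moves)

lemma transport_fibre: "fibre g v (\<theta> y) = fibre f v y"
  unfolding fibre_def bij_ex[OF bij, where P="\<lambda>a. \<exists>z. _ a z \<and> _ a z"] bij_ex[OF bij, where P="\<lambda>z. origin g _ z \<and> _ z"]
  by (simp add: transport_moves transport_origin)

lemma transport_actor: "actor g v k (\<theta> a) = actor f v k a"
  unfolding actor_def bij_ex[OF bij, where P="\<lambda>y. fibre g _ y \<and> _ y"]
  by (simp add: transport_moves transport_fibre)

lemma transport_inert: "inert g (\<theta> y) = inert f y"
  unfolding inert_def bij_all[OF bij, where P="\<lambda>z. _ z = z \<and> _ z"]
  by (simp add: transport_op transport_eq)

lemma transport_decode: "decode g = decode f"
  unfolding decode_def fun_eq_iff bij_ex[OF bij, where P="\<lambda>a. actor g _ _ a \<and> _ a"]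
  by (simp add: transport_actor)

lemma transport_shifted: "shifted g j (\<theta> z) (\<theta> y) = shifted f j z y"
  unfolding shifted_def bij_ex[OF bij, where P="\<lambda>c. hubs g c \<and> _ c"]
  by (simp add: transport_hubs transport_funpow transport_eq)

end

text \<open>Names an element of the copy for each live element of the word quandle. Which flip is
  \<open>Flip False\<close> and where a fibre has its zero is not definable, so the least candidate
  serves as base point.\<close>

fun pick :: "(nat \<Rightarrow> nat \<Rightarrow> nat) \<Rightarrow> elem \<Rightarrow> nat" where
  "pick g Hub = (LEAST c. hubs g c)"
| "pick g (Flip b) = (let p = LEAST p. flips g p in if b then g (LEAST c. hubs g c) p else p)"
| "pick g (Act v) = (LEAST a. actor g v (Same (fst v) []) a)"
| "pick g (Lbl v u) = (LEAST a. actor g v (Lab u) a)"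
| "pick g (Fib v j) = (LEAST y. shifted g j (LEAST z. fibre g v z) y)"

section \<open>The definable notions evaluated in word quandles and their copies\<close>

context word_coding
begin

lemma hubs_qop: "hubs (qop \<sigma>) c \<longleftrightarrow> c = Hub"
  by (auto simp: hubs_def qop_2cycle_iff)

lemma flips_qop: "flips (qop \<sigma>) p \<longleftrightarrow> (\<exists>b. p = Flip b)"
  by (auto simp: flips_def qop_2cycle_iff)

lemma moves_qop: "moves (qop \<sigma>) k a y \<longleftrightarrow> (\<exists>v j. y = Fib v j \<and> weight \<sigma> a v = k)"
  using qop_moved_iff[of \<sigma> y] by (auto simp: moves_def hubs_qop qop_Hub_funpow)

lemma origin_qop: "origin (qop \<sigma>) n y \<longleftrightarrow> (\<exists>j. y = Fib (n, []) j)"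
proof
  assume o: "origin (qop \<sigma>) n y"
  then obtain s j where y: "y = Fib (n, s) j"
    by (auto simp: origin_def moves_qop weight_Same_iff)
  \<comment> \<open>For nonempty \<open>s\<close> this weight is excluded by
    \<open>origin\<close>.\<close>
  then have "moves (qop \<sigma>) (wt (Same n s)) (Act (n, [])) y"
    by (simp add: moves_qop weight_Same_iff)
  with o y show "\<exists>j. y = Fib (n, []) j"
    unfolding origin_def by blast
qed (auto simp: origin_def moves_qop weight_Same_iff)

lemma fibre_qop: "fibre (qop \<sigma>) v y \<longleftrightarrow> (\<exists>j. y = Fib v j)"
proof
  assume "\<exists>j. y = Fib v j"
  then have "origin (qop \<sigma>) (fst v) (Fib (fst v, []) 0) \<and>
      moves (qop \<sigma>) (wt (Same (fst v) [])) (Act (fst v, [])) (Fib (fst v, []) 0) \<and>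
      moves (qop \<sigma>) (wt (Same (fst v) (snd v))) (Act (fst v, [])) y"
    by (cases v) (auto simp: moves_qop origin_qop weight_Same_iff)
  then show "fibre (qop \<sigma>) v y" unfolding fibre_def by blast
qed (auto simp: fibre_def moves_qop origin_qop weight_Same_iff)

lemma actor_Same_qop: "actor (qop \<sigma>) v (Same (fst v) []) a \<longleftrightarrow> a = Act v"
  by (cases v) (auto simp: actor_def moves_qop fibre_qop weight_Same_iff)

lemma actor_Lab_qop: "actor (qop \<sigma>) v (Lab u) a \<longleftrightarrow> a = Lbl v u \<and> labelled \<sigma> v u"
  by (cases v) (auto simp: actor_def moves_qop fibre_qop weight_Lab_iff)

lemma inert_qop: "inert (qop \<sigma>) e \<longleftrightarrow> \<not> live \<sigma> e"
proof
  assume i: "inert (qop \<sigma>) e"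
  show "\<not> live \<sigma> e"
  proof (cases e)
    case Hub
    then show ?thesis using i by (auto simp: inert_def dest: spec[of _ "Flip True"])
  next
    case (Flip b)
    then show ?thesis using i by (auto simp: inert_def dest: spec[of _ "Hub"])
  next
    case (Act v)
    have "weight \<sigma> (Act v) v = wt (Same (fst v) [])"
      unfolding weight_Same_iff by (cases v) auto
    then show ?thesis using i Act by (auto simp: inert_def dest: spec[of _ "Fib v 0"])
  next
    case (Lbl v u)
    then show ?thesis using i by (auto simp: inert_def dest: spec[of _ "Fib v 0"])
  next
    case (Fib v j)
    then show ?thesis using i by (auto simp: inert_def dest: spec[of _ "Hub"])
  qed
qed (auto simp: inert_def not_live)

lemma decode_qop: "decode (qop \<sigma>) = \<sigma>"
  by (auto simp: fun_eq_iff decode_def actor_Lab_qop labelled_def)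

lemma shifted_qop: "shifted (qop \<sigma>) j (Fib v i) y \<longleftrightarrow> y = Fib v (i + j)"
proof -
  have "qop \<sigma> Hub z = Fib v i \<longleftrightarrow> z = Fib v (i - 1)" for z i
    by (cases z) auto
  then have *: "(qop \<sigma> Hub ^^ k) y = Fib v i \<longleftrightarrow> y = Fib v (i - int k)" for k i
    by (induction k arbitrary: i) (auto simp: algebra_simps)
  show ?thesis by (auto simp: shifted_def hubs_qop qop_Hub_funpow *)
qed

text \<open>The arbitrary base points show only as a swap of the flips, recorded by
  \<open>b\<^sub>0\<close>, and a shift \<open>\<delta> v\<close> of each fibre. For a dead
  \<open>Lbl v u\<close> the \<open>LEAST\<close> ranges over the empty set, hence the
  condition.\<close>

lemma pick_copy:
  assumes bij: "bij \<theta>" and hom: "quandle_hom (qop \<sigma>) g \<theta>"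
  obtains b\<^sub>0 \<delta> where
    "pick g Hub = \<theta> Hub" "\<And>b. pick g (Flip b) = \<theta> (Flip (b \<noteq> b\<^sub>0))"
    "\<And>v. pick g (Act v) = \<theta> (Act v)" "\<And>v u. labelled \<sigma> v u \<Longrightarrow> pick g (Lbl v u) = \<theta> (Lbl v u)"
    "\<And>v j. pick g (Fib v j) = \<theta> (Fib v (\<delta> v + j))"
proof -
  note t = transport_hubs[OF bij hom] transport_flips[OF bij hom] transport_actor[OF bij hom]
    transport_fibre[OF bij hom] transport_shifted[OF bij hom]
  have L: "\<exists>e. (LEAST y. P y) = \<theta> e \<and> P (\<theta> e)" if "P (\<theta> x)" for P x
    using LeastI[of P, OF that] bij by (metis bij_pointE)
  have Hub: "(LEAST c. hubs g c) = \<theta> Hub"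
    using L[of "hubs g" Hub] by (auto simp: t hubs_qop)
  obtain b\<^sub>0 where b0: "(LEAST c. flips g c) = \<theta> (Flip b\<^sub>0)"
    using L[of "flips g" "Flip True"] by (auto simp: t flips_qop)
  have "\<exists>\<delta>. (LEAST z. fibre g v z) = \<theta> (Fib v \<delta>)" for v
    using L[of "fibre g v" "Fib v 0"] by (auto simp: t fibre_qop)
  then obtain \<delta> where \<delta>: "\<And>v. (LEAST z. fibre g v z) = \<theta> (Fib v (\<delta> v))" by metis
  show thesis
  proof (rule that[of b\<^sub>0 \<delta>])
    show "pick g Hub = \<theta> Hub" by (simp add: Hub)
    show "pick g (Flip b) = \<theta> (Flip (b \<noteq> b\<^sub>0))" for b
      by (simp add: Hub b0 Let_def transport_op[OF bij hom])
    show "pick g (Act v) = \<theta> (Act v)" for v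
      using L[of "actor g v (Same (fst v) [])" "Act v"] by (auto simp: t actor_Same_qop)
    show "pick g (Lbl v u) = \<theta> (Lbl v u)" if "labelled \<sigma> v u" for v u
      using L[of "actor g v (Lab u)" "Lbl v u"] that by (auto simp: t actor_Lab_qop)
    show "pick g (Fib v j) = \<theta> (Fib v (\<delta> v + j))" for v j
      using L[of "shifted g j (\<theta> (Fib v (\<delta> v)))" "Fib v (\<delta> v + j)"]
      by (auto simp: t \<delta> shifted_qop)
  qed
qed

text \<open>Expresses isomorphism with \<open>qop \<sigma>\<close> without quantifying over maps:
  \<open>pick\<close> presents the live elements, and the inert ones only have to be infinite in
  number.\<close>

definition copies :: "(nat \<Rightarrow> bool) \<Rightarrow> (nat \<Rightarrow> nat \<Rightarrow> nat) \<Rightarrow> bool" where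
  "copies \<sigma> g \<longleftrightarrow>
     (\<forall>e e'. live \<sigma> e \<longrightarrow> live \<sigma> e' \<longrightarrow> pick g (qop \<sigma> e e') = g (pick g e) (pick g e')) \<and>
     (\<forall>e e'. live \<sigma> e \<longrightarrow> live \<sigma> e' \<longrightarrow> pick g e = pick g e' \<longrightarrow> e = e') \<and>
     (\<forall>y. (\<exists>e. live \<sigma> e \<and> pick g e = y) \<longleftrightarrow> \<not> inert g y) \<and>
     infinite {y. inert g y}"

lemma copies_of_iso:
  assumes "quandle_iso (qop \<sigma>) g"
  shows "copies \<sigma> g"
proof -
  obtain \<theta> where bij: "bij \<theta>" and hom: "quandle_hom (qop \<sigma>) g \<theta>"
    using assms by (auto simp: quandle_iso_def)
  note t = transport_op[OF bij hom] transport_eq[OF bij hom]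
  obtain b\<^sub>0 \<delta> where pick: "pick g Hub = \<theta> Hub" "\<And>b. pick g (Flip b) = \<theta> (Flip (b \<noteq> b\<^sub>0))"
    "\<And>v. pick g (Act v) = \<theta> (Act v)" "\<And>v u. labelled \<sigma> v u \<Longrightarrow> pick g (Lbl v u) = \<theta> (Lbl v u)"
    "\<And>v j. pick g (Fib v j) = \<theta> (Fib v (\<delta> v + j))"
    using pick_copy[OF bij hom] by metis
  \<comment> \<open>The automorphism of \<open>qop \<sigma>\<close> by which \<open>pick g\<close>
    differs from \<theta> on live elements.\<close>
  define \<rho> where "\<rho> e = (case e of Flip b \<Rightarrow> Flip (b \<noteq> b\<^sub>0) | Fib v j \<Rightarrow> Fib v (\<delta> v + j) | _ \<Rightarrow> e)" for e
  have pk: "pick g e = \<theta> (\<rho> e)" if "live \<sigma> e" for e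
    using that by (cases e) (auto simp: pick \<rho>_def simp del: pick.simps)
  have \<rho>: "live \<sigma> (\<rho> e) = live \<sigma> e" "\<rho> e = \<rho> e' \<longleftrightarrow> e = e'" "weight \<sigma> (\<rho> e) v = weight \<sigma> e v"
    "\<rho> e = Hub \<longleftrightarrow> e = Hub" for e e' v
    by (cases e; cases e'; auto simp: \<rho>_def)+
  have \<rho>_op: "\<rho> (qop \<sigma> e e') = qop \<sigma> (\<rho> e) (\<rho> e')" for e e'
    using \<rho>(3,4)[of e] by (cases e') (auto simp: \<rho>_def)
  have \<rho>_surj: "\<exists>e'. \<rho> e' = e" for e
  proof -
    have "\<rho> (case e of Flip b \<Rightarrow> Flip (b \<noteq> b\<^sub>0) | Fib v j \<Rightarrow> Fib v (j - \<delta> v) | _ \<Rightarrow> e) = e"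
      by (cases e) (auto simp: \<rho>_def)
    then show ?thesis by blast
  qed
  have "(\<exists>e. live \<sigma> e \<and> pick g e = y) \<longleftrightarrow> \<not> inert g y" for y
  proof -
    obtain e where e: "y = \<theta> (\<rho> e)" using bij \<rho>_surj by (metis bij_pointE)
    have "(\<exists>e. live \<sigma> e \<and> pick g e = y) \<longleftrightarrow> live \<sigma> e"
      using pk by (auto simp: e t \<rho>)
    then show ?thesis by (simp add: e transport_inert[OF bij hom] inert_qop \<rho>)
  qed
  moreover have "infinite {y. inert g y}"
  proof
    assume "finite {y. inert g y}"
    moreover have "{y. inert g y} = \<theta> ` {e. \<not> live \<sigma> e}"
      using bij transport_inert[OF bij hom] inert_qop by (auto simp: bij_pointE) (metis bij_pointE imageI mem_Collect_eq)
    ultimately show False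
      using infinite_not_live bij by (metis bij_betw_imp_inj_on finite_imageD inj_on_subset subset_UNIV)
  qed
  ultimately show ?thesis
    unfolding copies_def by (auto simp: pk t \<rho> \<rho>_op)
qed

text \<open>The dead elements and the inert points are countably infinite and neither act nor are
  moved, so any bijection between them completes \<open>pick g\<close> to an isomorphism.\<close>

lemma iso_of_copies:
  assumes "copies \<sigma> g"
  shows "quandle_iso (qop \<sigma>) g"
proof -
  have hom: "live \<sigma> e \<Longrightarrow> live \<sigma> e' \<Longrightarrow> pick g (qop \<sigma> e e') = g (pick g e) (pick g e')"
    and inj: "live \<sigma> e \<Longrightarrow> live \<sigma> e' \<Longrightarrow> pick g e = pick g e' \<Longrightarrow> e = e'"
    and range: "(\<exists>e. live \<sigma> e \<and> pick g e = y) \<longleftrightarrow> \<not> inert g y"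
    and inf: "infinite {y. inert g y}" for e e' y
    using assms unfolding copies_def by blast+
  obtain f where f: "bij_betw f {e. \<not> live \<sigma> e} {y. inert g y}"
    using countable_infinite_bij[OF _ infinite_not_live _ inf] by blast
  have "bij_betw (pick g) {e. live \<sigma> e} {y. \<not> inert g y}"
    unfolding bij_betw_def
  proof
    show "inj_on (pick g) {e. live \<sigma> e}" by (rule inj_onI) (simp add: inj)
    show "pick g ` {e. live \<sigma> e} = {y. \<not> inert g y}"
      unfolding range[symmetric] by auto
  qed
  from bij_betw_disjoint_Un[OF this f]
  have "bij_betw (\<lambda>e. if e \<in> {e. live \<sigma> e} then pick g e else f e)
     ({e. live \<sigma> e} \<union> {e. \<not> live \<sigma> e}) ({y. \<not> inert g y} \<union> {y. inert g y})"
    by blast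
  moreover define h where "h = (\<lambda>e. if live \<sigma> e then pick g e else f e)"
  moreover have "{e. live \<sigma> e} \<union> {e. \<not> live \<sigma> e} = UNIV" "{y. \<not> inert g y} \<union> {y. inert g y} = UNIV"
    by auto
  ultimately have "bij h"
    by (simp only: h_def mem_Collect_eq)
  moreover have "h (qop \<sigma> x y) = g (h x) (h y)" for x y
  proof -
    have f': "inert g (f e)" if "\<not> live \<sigma> e" for e
      using bij_betwE[OF f] that by blast
    show ?thesis
    proof (cases "live \<sigma> x \<and> live \<sigma> y")
      case True
      then show ?thesis by (simp add: h_def hom)
    next
      case False
      then have "qop \<sigma> x y = y" "g (h x) (h y) = h y"
        using f' by (auto simp: not_live h_def inert_def)
      then show ?thesis by simp
    qed
  qed
  ultimately show ?thesis unfolding quandle_iso_def quandle_hom_def by blast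
qed

end

subsection \<open>Coding of analytic relations\<close>

lemma measurable_borel_countable:
  "M \<rightarrow>\<^sub>M (borel :: 'b::{countable, t2_space} measure) = M \<rightarrow>\<^sub>M count_space UNIV"
  by (rule measurable_cong_sets) (simp_all add: sets_borel_eq_count_space)

lemma measurable_bool_coordinate [measurable]:
  "Measurable.pred borel (\<lambda>\<sigma> :: 'i \<Rightarrow> bool. \<sigma> i)"
  unfolding measurable_borel_countable[symmetric] by (rule measurable_product_coordinates)

text \<open>Yields a countable base for countable powers of \<open>bool\<close>, so that
  measurability into them can be checked coordinatewise.\<close>

instance bool :: second_countable_topology
proof
  have "open = generate_topology (UNIV :: bool set set)"
    by (intro ext) (auto simp: open_discrete intro: generate_topology.Basis)
  then show "\<exists>B :: bool set set. countable B \<and> open = generate_topology B"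
    by (metis countable_finite finite)
qed

lemma measurable_bool_functionI:
  assumes "\<And>i. Measurable.pred M (\<lambda>x. f x i)"
  shows "(f :: 'a \<Rightarrow> 'i::countable \<Rightarrow> bool) \<in> borel_measurable M"
  using assms unfolding measurable_borel_countable[symmetric]
  by (rule measurable_coordinatewise_then_product)

lemma closure_refinement:
  assumes base: "\<And>V x. openin T V \<Longrightarrow> x \<in> V \<Longrightarrow> \<exists>n. x \<in> U n \<and> U n \<subseteq> V"
    and "regular_space T" "openin T V" "x \<in> V" and U: "\<And>n. openin T (U n)"
  shows "\<exists>l::nat. x \<in> U l \<and> T closure_of U l \<subseteq> V"
proof -
  have "closedin T (topspace T - V)" "x \<in> topspace T - (topspace T - V)"
    using assms openin_subset by fastforce+
  then obtain W where W: "openin T W" "x \<in> W" "disjnt (topspace T - V) (T closure_of W)"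
    using \<open>regular_space T\<close> unfolding regular_space by blast
  obtain l where l: "x \<in> U l" "U l \<subseteq> W" using base W by blast
  have "T closure_of U l \<subseteq> T closure_of W" using l closure_of_mono by blast
  moreover have "T closure_of W \<subseteq> V"
    using W(3) closure_of_subset_topspace[of T W] by (auto simp: disjnt_def)
  ultimately show ?thesis using l by blast
qed

text \<open>A point is coded by the set of basic open sets containing it. By completeness the codes are
  exactly the upward closed families with arbitrarily small members in which any two members
  contain the closure of a third, and this is a Borel condition.\<close>

lemma standard_borel_coding:
  fixes M :: "'a measure"
  assumes "standard_borel M"
  obtains c :: "'a \<Rightarrow> nat \<Rightarrow> bool" and r :: "(nat \<Rightarrow> bool) \<Rightarrow> 'a"
  where "c \<in> M \<rightarrow>\<^sub>M borel" "c ` space M \<in> sets borel"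
    "r \<in> restrict_space borel (c ` space M) \<rightarrow>\<^sub>M M" "\<And>x. x \<in> space M \<Longrightarrow> r (c x) = x"
proof -
  obtain T where T: "completely_metrizable_space T" "second_countable T"
      "space M = topspace T" "sets M = sigma_sets (topspace T) {U. openin T U}"
    using assms unfolding standard_borel_def by blast
  obtain X d where "Metric_space X d" and mc: "Metric_space.mcomplete X d"
      and TX: "T = Metric_space.mtopology X d"
    using T(1) unfolding completely_metrizable_space_def by blast
  interpret Metric_space X d by fact
  have top: "topspace T = X" by (simp add: TX)
  obtain \<B> where \<B>: "countable \<B>" "\<forall>V\<in>\<B>. openin T V"
      "\<forall>V x. openin T V \<and> x \<in> V \<longrightarrow> (\<exists>W\<in>\<B>. x \<in> W \<and> W \<subseteq> V)"
    using T(2) unfolding second_countable_def by blast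
  \<comment> \<open>The empty set is added so that the enumerated family is nonempty even over an
    empty space; \<open>K\<close> excludes it from codes.\<close>
  define U where "U = from_nat_into (insert {} \<B>)"
  have range_U: "range U = insert {} \<B>"
    unfolding U_def using \<B>(1) by (intro range_from_nat_into) auto
  have U: "openin T (U n)" for n
    using range_U \<B>(2) by (metis insertE openin_empty rangeI)
  have base: "\<exists>n. x \<in> U n \<and> U n \<subseteq> V" if "openin T V" "x \<in> V" for V x
    using \<B>(3) that range_U by (metis imageE insertI2)
  have reg: "regular_space T" using regular_space_mtopology by (simp add: TX)
  have UX: "U n \<subseteq> X" for n using U openin_subset top by metis
  have UM: "U n \<in> sets M" for n using U T(4) by auto
  define c :: "'a \<Rightarrow> nat \<Rightarrow> bool" where "c x n \<longleftrightarrow> x \<in> U n" for x n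
  have c: "c \<in> M \<rightarrow>\<^sub>M borel"
    unfolding c_def using UM by (intro measurable_bool_functionI) auto
  have inj: "inj_on c (space M)"
  proof (rule inj_onI, rule ccontr)
    fix x y assume xy: "x \<in> space M" "y \<in> space M" "c x = c y" "x \<noteq> y"
    then have "openin T (mball x (d x y))" "x \<in> mball x (d x y)" "y \<notin> mball x (d x y)"
      using T(3) top by (auto simp: TX)
    then show False using base xy(3) unfolding c_def fun_eq_iff by blast
  qed
  define small where "small k n \<longleftrightarrow> U n \<noteq> {} \<and> (\<exists>a. U n \<subseteq> mcball a (1 / Suc k))" for k n
  define K where "K = {\<sigma>. (\<forall>k. \<exists>n. \<sigma> n \<and> small k n) \<and> (\<forall>n. \<sigma> n \<longrightarrow> U n \<noteq> {}) \<and>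
     (\<forall>n m. \<sigma> n \<and> \<sigma> m \<longrightarrow> (\<exists>l. \<sigma> l \<and> T closure_of U l \<subseteq> U n \<inter> U m)) \<and>
     (\<forall>n m. \<sigma> m \<and> U m \<subseteq> U n \<longrightarrow> \<sigma> n)}"
  have "K = {\<sigma>\<in>space borel. (\<forall>k. \<exists>n. \<sigma> n \<and> small k n) \<and> (\<forall>n. \<sigma> n \<longrightarrow> U n \<noteq> {}) \<and>
     (\<forall>n m. \<sigma> n \<and> \<sigma> m \<longrightarrow> (\<exists>l. \<sigma> l \<and> T closure_of U l \<subseteq> U n \<inter> U m)) \<and>
     (\<forall>n m. \<sigma> m \<and> U m \<subseteq> U n \<longrightarrow> \<sigma> n)}"
    by (simp add: K_def)
  also have "\<dots> \<in> sets borel" by measurable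
  finally have K_borel: "K \<in> sets borel" .
  have "c x \<in> K" if x: "x \<in> X" for x
    unfolding K_def mem_Collect_eq
  proof (intro conjI allI impI)
    fix k
    have "openin T (mball x (1 / Suc k))" "x \<in> mball x (1 / Suc k)" using x by (auto simp: TX)
    then obtain n where "x \<in> U n" "U n \<subseteq> mball x (1 / Suc k)" using base by blast
    then show "\<exists>n. c x n \<and> small k n"
      unfolding c_def small_def using mball_subset_mcball by blast
  next
    fix n m assume "c x n \<and> c x m"
    then show "\<exists>l. c x l \<and> T closure_of U l \<subseteq> U n \<inter> U m"
      unfolding c_def using closure_refinement[OF base reg, of "U n \<inter> U m" x] U by blast
  qed (auto simp: c_def)
  moreover have "\<sigma> \<in> c ` X" if \<sigma>: "\<sigma> \<in> K" for \<sigma>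
  proof -
    have small: "\<exists>n. \<sigma> n \<and> small k n" and ne: "\<sigma> n \<Longrightarrow> U n \<noteq> {}"
      and ref: "\<sigma> n \<Longrightarrow> \<sigma> m \<Longrightarrow> \<exists>l. \<sigma> l \<and> T closure_of U l \<subseteq> U n \<inter> U m"
      and up: "\<sigma> m \<Longrightarrow> U m \<subseteq> U n \<Longrightarrow> \<sigma> n" for k n m
      using \<sigma> unfolding K_def by blast+
    have cl: "U n \<subseteq> T closure_of U n" for n
      using UX top by (simp add: closure_of_subset)
    let ?C = "(\<lambda>n. T closure_of U n) ` {n. \<sigma> n}"
    \<comment> \<open>Cantor's intersection theorem: closed sets with the finite intersection
      property and members inside arbitrarily small balls have exactly one common point.\<close>
    have "\<exists>x. x \<in> X \<and> \<Inter> ?C = {x}"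
    proof (rule mcomplete_fip_sing[THEN iffD1, OF mc, rule_format], intro conjI allI impI ballI)
      fix C assume "C \<in> ?C"
      then show "closedin mtopology C" by (auto simp: TX)
    next
      fix e :: real assume "e > 0"
      then obtain k where k: "1 / Suc k < e" using nat_approx_posE by blast
      obtain n a where n: "\<sigma> n" "U n \<subseteq> mcball a (1 / Suc k)" using small unfolding small_def by blast
      then have "T closure_of U n \<subseteq> mcball a (1 / Suc k)"
        by (intro closure_of_minimal) (auto simp: TX)
      also have "\<dots> \<subseteq> mcball a e" using k by (intro mcball_subset_concentric) auto
      finally show "\<exists>C a. C \<in> ?C \<and> C \<subseteq> mcball a e" using n by blast
    next
      fix \<F> assume "finite \<F> \<and> \<F> \<subseteq> ?C"
      then obtain I where I: "finite I" "I \<subseteq> {n. \<sigma> n}" "\<F> = (\<lambda>n. T closure_of U n) ` I"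
        by (meson finite_subset_image)
      \<comment> \<open>The sets coded by \<sigma> are directed downwards, and none of them is
        empty.\<close>
      from I(1,2) have "\<exists>l. \<sigma> l \<and> (\<forall>i\<in>I. U l \<subseteq> U i)"
      proof (induction I)
        case empty
        then show ?case using small by blast
      next
        case (insert i I)
        then obtain l where l: "\<sigma> l" "\<forall>i\<in>I. U l \<subseteq> U i" by auto
        with insert ref[of l i] obtain l' where "\<sigma> l'" "T closure_of U l' \<subseteq> U l \<inter> U i" by auto
        then show ?case using l cl[of l'] by blast
      qed
      then obtain l where "\<sigma> l" "\<forall>i\<in>I. U l \<subseteq> U i" by blast
      then show "\<Inter> \<F> \<noteq> {}" using ne[of l] cl unfolding I(3) by blast
    qed
    then obtain x where x: "x \<in> X" "\<And>n. \<sigma> n \<Longrightarrow> x \<in> T closure_of U n" by blast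
    have sub: "x \<in> U n" if "\<sigma> n" for n
      using ref[OF that that] x(2) by blast
    \<comment> \<open>A coded set of radius below \<epsilon>/2 contains \<open>x\<close>, so it lies
      in the \<epsilon>-ball inside \<open>U n\<close>, and upward closure applies.\<close>
    moreover have "\<sigma> n" if "x \<in> U n" for n
    proof -
      obtain \<epsilon> where \<epsilon>: "\<epsilon> > 0" "mball x \<epsilon> \<subseteq> U n"
        using U[of n] \<open>x \<in> U n\<close> unfolding TX openin_mtopology by blast
      then obtain k where k: "1 / Suc k < \<epsilon> / 2" using nat_approx_posE[of "\<epsilon> / 2"] by auto
      obtain m a where m: "\<sigma> m" "U m \<subseteq> mcball a (1 / Suc k)" using small unfolding small_def by blast
      have "U m \<subseteq> mball x \<epsilon>"
      proof
        fix y assume y: "y \<in> U m"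
        then have "d a x \<le> 1 / Suc k" "d a y \<le> 1 / Suc k" "a \<in> X" "y \<in> X"
          using m sub[of m] by auto
        then show "y \<in> mball x \<epsilon>"
          using triangle[of x a y] k x(1) by (simp add: commute)
      qed
      then show ?thesis using \<epsilon> m(1) up by blast
    qed
    ultimately have "\<sigma> = c x" by (auto simp: c_def fun_eq_iff)
    then show ?thesis using x(1) by blast
  qed
  ultimately have K: "c ` space M = K" using T(3) top by auto
  define r where "r = inv_into (space M) c"
  have rc: "r (c x) = x" if "x \<in> space M" for x
    using inj that by (simp add: r_def)
  have "r \<in> restrict_space borel K \<rightarrow>\<^sub>M M"
  proof (rule measurable_sigma_sets[OF T(4)])
    show "{U. openin T U} \<subseteq> Pow (topspace T)" using openin_subset by blast
    show "r \<in> space (restrict_space borel K) \<rightarrow> topspace T"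
      using rc T(3) K by (auto simp: space_restrict_space)
    fix V assume "V \<in> {U. openin T U}"
    then have V: "openin T V" by simp
    have eq: "r -` V \<inter> K = K \<inter> {\<sigma>\<in>space borel. \<exists>n. U n \<subseteq> V \<and> \<sigma> n}"
    proof -
      have "x \<in> V \<longleftrightarrow> (\<exists>n. U n \<subseteq> V \<and> c x n)" for x
        using base[OF V, of x] unfolding c_def by blast
      then show ?thesis unfolding K[symmetric] using rc by auto
    qed
    have "r -` V \<inter> K \<in> sets borel"
      unfolding eq using K_borel by measurable
    then show "r -` V \<inter> space (restrict_space borel K) \<in> sets (restrict_space borel K)"
      using K_borel by (simp add: sets_restrict_space_iff)
  qed
  then show thesis using that[of c r] c K_borel rc unfolding K by blast
qed

section \<open>Borel sets of the Baire space as projections of closed sets\<close>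

definition souslin :: "(nat \<Rightarrow> nat) set \<Rightarrow> bool" where
  "souslin A \<longleftrightarrow> (\<exists>F. \<forall>\<gamma>. \<gamma> \<in> A \<longleftrightarrow> (\<exists>\<alpha>. \<forall>n. F (restr n \<gamma>) (restr n \<alpha> :: nat list)))"

lemma restr_Suc: "restr (Suc n) f = f 0 # restr n (\<lambda>i. f (Suc i))"
  by (simp add: restr_def upt_conv_Cons map_Suc_upt[symmetric] del: upt_Suc)

lemma map_nth_restr: "(\<And>i. i < n \<Longrightarrow> p i < N) \<Longrightarrow> map (\<lambda>i. restr N f ! p i) [0..<n] = restr n (\<lambda>i. f (p i))"
  by (simp add: restr_def)

lemma souslin_coordinate: "souslin {\<gamma>. \<gamma> i \<in> X}"
  unfolding souslin_def
proof (intro exI[of _ "\<lambda>l _. i < length l \<longrightarrow> l ! i \<in> X"] allI)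
  fix \<gamma> :: "nat \<Rightarrow> nat"
  show "\<gamma> \<in> {\<gamma>. \<gamma> i \<in> X} \<longleftrightarrow> (\<exists>\<alpha> :: nat \<Rightarrow> nat. \<forall>n. i < length (restr n \<gamma>) \<longrightarrow> restr n \<gamma> ! i \<in> X)"
    by (auto dest: spec[of _ "Suc i"])
qed

lemma souslin_UN:
  assumes "\<And>i::nat. souslin (A i)"
  shows "souslin (\<Union>i. A i)"
proof -
  obtain F where F: "\<And>i \<gamma>. \<gamma> \<in> A i \<longleftrightarrow> (\<exists>\<alpha>. \<forall>n. F i (restr n \<gamma>) (restr n \<alpha> :: nat list))"
    using assms unfolding souslin_def by metis
  \<comment> \<open>The witness starts with the chosen index. The rest of it is one entry shorter,
    so \<open>l\<close> is cut to the same length.\<close>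
  define G where "G l a \<longleftrightarrow> (case a of [] \<Rightarrow> True | i # b \<Rightarrow> F i (take (length b) l) b)" for l a
  have G: "(\<forall>n. G (restr n \<gamma>) (restr n \<alpha>)) \<longleftrightarrow> (\<forall>n. F (\<alpha> 0) (restr n \<gamma>) (restr n (\<lambda>i. \<alpha> (Suc i))))" for \<gamma> \<alpha>
  proof
    assume *: "\<forall>n. G (restr n \<gamma>) (restr n \<alpha>)"
    show "\<forall>n. F (\<alpha> 0) (restr n \<gamma>) (restr n (\<lambda>i. \<alpha> (Suc i)))"
    proof
      fix n show "F (\<alpha> 0) (restr n \<gamma>) (restr n (\<lambda>i. \<alpha> (Suc i)))"
        using spec[OF *, of "Suc n"] by (simp add: G_def restr_Suc[of n \<alpha>] take_restr)
    qed
  next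
    assume *: "\<forall>n. F (\<alpha> 0) (restr n \<gamma>) (restr n (\<lambda>i. \<alpha> (Suc i)))"
    show "\<forall>n. G (restr n \<gamma>) (restr n \<alpha>)"
    proof
      fix n show "G (restr n \<gamma>) (restr n \<alpha>)"
      proof (cases n)
        case 0
        then show ?thesis by (simp add: G_def restr_def)
      next
        case (Suc m)
        then show ?thesis using * by (simp add: G_def restr_Suc[of m \<alpha>] take_restr)
      qed
    qed
  qed
  have "\<gamma> \<in> (\<Union>i. A i) \<longleftrightarrow> (\<exists>\<alpha>. \<forall>n. G (restr n \<gamma>) (restr n \<alpha>))" for \<gamma>
  proof
    assume "\<gamma> \<in> (\<Union>i. A i)"
    then obtain i \<alpha> where "\<forall>n. F i (restr n \<gamma>) (restr n \<alpha>)" using F by auto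
    then show "\<exists>\<alpha>. \<forall>n. G (restr n \<gamma>) (restr n \<alpha>)"
      by (intro exI[of _ "case_nat i \<alpha>"]) (simp add: G)
  next
    assume "\<exists>\<alpha>. \<forall>n. G (restr n \<gamma>) (restr n \<alpha>)"
    then obtain \<alpha> where "\<forall>n. F (\<alpha> 0) (restr n \<gamma>) (restr n (\<lambda>i. \<alpha> (Suc i)))" unfolding G by blast
    then have "\<gamma> \<in> A (\<alpha> 0)" unfolding F by blast
    then show "\<gamma> \<in> (\<Union>i. A i)" by blast
  qed
  then show ?thesis unfolding souslin_def by blast
qed

lemma souslin_INT:
  assumes "\<And>i::nat. souslin (A i)"
  shows "souslin (\<Inter>i. A i)"
proof -
  obtain F where F: "\<And>i \<gamma>. \<gamma> \<in> A i \<longleftrightarrow> (\<exists>\<alpha>. \<forall>n. F i (restr n \<gamma>) (restr n \<alpha> :: nat list))"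
    using assms unfolding souslin_def by metis
  \<comment> \<open>One witness interleaves those for all \<open>i\<close>. The condition for
    \<open>i\<close> and \<open>n\<close> is imposed once \<open>a\<close> is long enough to contain
    the entries concerned, which happens eventually by \<open>bound\<close>.\<close>
  define G where "G l a \<longleftrightarrow> (\<forall>i n. n \<le> length l \<longrightarrow> (\<forall>m<n. prod_encode (i, m) < length a) \<longrightarrow>
      F i (take n l) (map (\<lambda>m. a ! prod_encode (i, m)) [0..<n]))" for l and a :: "nat list"
  have bound: "\<exists>N\<ge>n. \<forall>m<n. prod_encode (i, m) < N" for i n
  proof -
    obtain N where "\<forall>k\<in>(\<lambda>m. prod_encode (i, m)) ` {..<n}. k < N"
      using finite_nat_set_iff_bounded by (metis finite_imageI finite_lessThan)
    then show ?thesis by (intro exI[of _ "max n N"]) (auto simp: less_max_iff_disj)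
  qed
  have G: "(\<forall>N. G (restr N \<gamma>) (restr N \<alpha>)) \<longleftrightarrow>
      (\<forall>i n. F i (restr n \<gamma>) (restr n (\<lambda>m. \<alpha> (prod_encode (i, m)))))" for \<gamma> \<alpha>
  proof
    assume *: "\<forall>N. G (restr N \<gamma>) (restr N \<alpha>)"
    show "\<forall>i n. F i (restr n \<gamma>) (restr n (\<lambda>m. \<alpha> (prod_encode (i, m))))"
    proof (intro allI)
      fix i n
      obtain N where N: "N \<ge> n" "\<forall>m<n. prod_encode (i, m) < N" using bound by blast
      then have "F i (take n (restr N \<gamma>)) (map (\<lambda>m. restr N \<alpha> ! prod_encode (i, m)) [0..<n])"
        using * unfolding G_def by auto
      then show "F i (restr n \<gamma>) (restr n (\<lambda>m. \<alpha> (prod_encode (i, m))))"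
        using N by (simp add: take_restr map_nth_restr cong: map_cong)
    qed
  next
    assume "\<forall>i n. F i (restr n \<gamma>) (restr n (\<lambda>m. \<alpha> (prod_encode (i, m))))"
    then show "\<forall>N. G (restr N \<gamma>) (restr N \<alpha>)"
      unfolding G_def by (simp add: take_restr map_nth_restr cong: map_cong)
  qed
  have "\<gamma> \<in> (\<Inter>i. A i) \<longleftrightarrow> (\<exists>\<alpha>. \<forall>n. G (restr n \<gamma>) (restr n \<alpha>))" for \<gamma>
  proof
    assume "\<gamma> \<in> (\<Inter>i. A i)"
    then obtain \<alpha> where "\<And>i n. F i (restr n \<gamma>) (restr n (\<alpha> i))" using F by (metis INT_E UNIV_I)
    then show "\<exists>\<alpha>. \<forall>n. G (restr n \<gamma>) (restr n \<alpha>)"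
      by (intro exI[of _ "\<lambda>k. case_prod \<alpha> (prod_decode k)"]) (simp add: G)
  next
    assume "\<exists>\<alpha>. \<forall>n. G (restr n \<gamma>) (restr n \<alpha>)"
    then obtain \<alpha> where "\<And>i n. F i (restr n \<gamma>) (restr n (\<lambda>m. \<alpha> (prod_encode (i, m))))" unfolding G by blast
    then have "\<gamma> \<in> A i" for i unfolding F by blast
    then show "\<gamma> \<in> (\<Inter>i. A i)" by blast
  qed
  then show ?thesis unfolding souslin_def by blast
qed

lemma borel_souslin:
  assumes "A \<in> sets (borel :: (nat \<Rightarrow> nat) measure)"
  shows "souslin A"
proof -
  have "sets (borel :: (nat \<Rightarrow> nat) measure) = sigma_sets UNIV {{\<gamma>. \<gamma> i \<in> X} |i X. X \<in> sets borel}"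
    unfolding sets_PiM_equal_borel[symmetric] sets_PiM_single by simp
  with assms have "A \<in> sigma_sets UNIV {{\<gamma>. \<gamma> i \<in> X} |i X. X \<in> sets borel}" by simp
  \<comment> \<open>Complements are carried along, as Souslin sets are closed under countable unions
    and intersections but not under complements.\<close>
  then have "souslin A \<and> souslin (- A)"
  proof induction
    case (Basic a)
    then obtain i X where a: "a = {\<gamma>. \<gamma> i \<in> X}" by blast
    then have "- a = {\<gamma>. \<gamma> i \<in> - X}" by auto
    then show ?case using souslin_coordinate a by metis
  next
    case Empty
    show ?case using souslin_coordinate[of 0 "{}"] souslin_coordinate[of 0 UNIV] by simp
  next
    case (Compl a)
    then show ?case by (simp add: Compl_eq_Diff_UNIV[symmetric])
  next
    case (Union a)
    then show ?case using souslin_UN[of a] souslin_INT[of "\<lambda>i. - a i"] by simp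
  qed
  then show ?thesis by blast
qed

lemma analytic_coding:
  fixes M :: "'a measure"
  assumes M: "standard_borel M" and R: "analytic_set (M \<Otimes>\<^sub>M M) R"
  obtains c :: "'a \<Rightarrow> nat \<Rightarrow> bool" and r :: "(nat \<Rightarrow> bool) \<Rightarrow> 'a" and F
  where "c \<in> M \<rightarrow>\<^sub>M borel" "c ` space M \<in> sets borel"
    "r \<in> restrict_space borel (c ` space M) \<rightarrow>\<^sub>M M" "\<And>x. x \<in> space M \<Longrightarrow> r (c x) = x"
    "word_coding F"
    "\<And>\<sigma> \<tau>. word_coding.rel F \<sigma> \<tau> \<longleftrightarrow> \<sigma> \<in> c ` space M \<and> \<tau> \<in> c ` space M \<and> (r \<sigma>, r \<tau>) \<in> R"
proof -
  obtain c :: "'a \<Rightarrow> nat \<Rightarrow> bool" and r where c: "c \<in> M \<rightarrow>\<^sub>M borel" "c ` space M \<in> sets borel"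
    "r \<in> restrict_space borel (c ` space M) \<rightarrow>\<^sub>M M" "\<And>x. x \<in> space M \<Longrightarrow> r (c x) = x"
    using standard_borel_coding[OF M] by metis
  define K where "K = c ` space M"
  have K [measurable]: "K \<in> sets borel" and r: "r \<in> restrict_space borel K \<rightarrow>\<^sub>M M"
    using c by (auto simp: K_def)
  obtain C where C: "C \<in> sets ((M \<Otimes>\<^sub>M M) \<Otimes>\<^sub>M (borel :: (nat \<Rightarrow> nat) measure))" "R = fst ` C"
    using R unfolding analytic_set_def by blast
  \<comment> \<open>\<open>souslin\<close> speaks of single sequences, so \<gamma> packs two codes
    and a point of the Baire space; a nonzero number is read as true.\<close>
  define s where "s \<gamma> i \<longleftrightarrow> fst (prod_decode (\<gamma> i)) \<noteq> 0" for \<gamma> :: "nat \<Rightarrow> nat" and i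
  define t where "t \<gamma> i \<longleftrightarrow> fst (prod_decode (snd (prod_decode (\<gamma> i)))) \<noteq> 0" for \<gamma> :: "nat \<Rightarrow> nat" and i
  define b where "b \<gamma> i = snd (prod_decode (snd (prod_decode (\<gamma> i))))" for \<gamma> :: "nat \<Rightarrow> nat" and i
  define enc where "enc p q k = prod_encode (of_bool p, prod_encode (of_bool q, k))" for p q k
  have dec: "s (\<lambda>i. enc (\<sigma> i) (\<tau> i) (\<beta> i)) = \<sigma>" "t (\<lambda>i. enc (\<sigma> i) (\<tau> i) (\<beta> i)) = \<tau>"
    "b (\<lambda>i. enc (\<sigma> i) (\<tau> i) (\<beta> i)) = \<beta>" for \<sigma> \<tau> \<beta>
    by (auto simp: s_def t_def b_def enc_def fun_eq_iff)
  have nat_fun: "(\<lambda>\<gamma>. f (\<gamma> i)) \<in> borel \<rightarrow>\<^sub>M count_space UNIV" for f :: "nat \<Rightarrow> 'z" and i :: nat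
    using measurable_product_coordinates[of i, where ?'b=nat] unfolding measurable_borel_countable
    by (rule measurable_compose) simp
  have s [measurable]: "s \<in> borel \<rightarrow>\<^sub>M borel" and t [measurable]: "t \<in> borel \<rightarrow>\<^sub>M borel"
    unfolding s_def t_def by (intro measurable_bool_functionI nat_fun)+
  have b: "b \<in> borel \<rightarrow>\<^sub>M borel"
    unfolding b_def
  proof (rule measurable_coordinatewise_then_product)
    show "(\<lambda>\<gamma>. snd (prod_decode (snd (prod_decode (\<gamma> i))))) \<in> borel_measurable borel" for i :: nat
      using nat_fun[of "\<lambda>x. snd (prod_decode (snd (prod_decode x)))" i]
      by (simp add: measurable_borel_countable)
  qed
  \<comment> \<open>\<open>r\<close> is known to be measurable only on \<open>K\<close>, so the
    preimage of \<open>C\<close> is taken where both codes are valid.\<close>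
  define \<Omega> where "\<Omega> = {\<gamma>\<in>space borel. s \<gamma> \<in> K \<and> t \<gamma> \<in> K}"
  have \<Omega>: "\<Omega> \<in> sets borel" unfolding \<Omega>_def by measurable
  have rs: "(\<lambda>\<gamma>. r (s \<gamma>)) \<in> restrict_space borel \<Omega> \<rightarrow>\<^sub>M M"
    by (rule measurable_compose[OF _ r], rule measurable_restrict_space2)
      (auto simp: \<Omega>_def space_restrict_space intro!: measurable_restrict_space1)
  have rt: "(\<lambda>\<gamma>. r (t \<gamma>)) \<in> restrict_space borel \<Omega> \<rightarrow>\<^sub>M M"
    by (rule measurable_compose[OF _ r], rule measurable_restrict_space2)
      (auto simp: \<Omega>_def space_restrict_space intro!: measurable_restrict_space1)
  let ?h = "\<lambda>\<gamma>. ((r (s \<gamma>), r (t \<gamma>)), b \<gamma>)"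
  have "?h \<in> restrict_space borel \<Omega> \<rightarrow>\<^sub>M (M \<Otimes>\<^sub>M M) \<Otimes>\<^sub>M borel"
    by (intro measurable_Pair rs rt measurable_restrict_space1[OF b])
  from measurable_sets[OF this C(1)]
  have "?h -` C \<inter> \<Omega> \<in> sets borel"
    using \<Omega> by (simp add: sets_restrict_space_iff)
  then obtain F\<^sub>0 where F0: "\<And>\<gamma>. ?h \<gamma> \<in> C \<and> \<gamma> \<in> \<Omega> \<longleftrightarrow> (\<exists>\<alpha>. \<forall>n. F\<^sub>0 (restr n \<gamma>) (restr n \<alpha> :: nat list))"
    using borel_souslin[of "?h -` C \<inter> \<Omega>"] unfolding souslin_def by auto
  \<comment> \<open>\<open>d\<close> pairs the entries of the Baire space witness with those of the
    Souslin witness, so that one existential quantifier remains.\<close>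
  define F where "F u v d \<longleftrightarrow> length u = length v \<and> length d = length v \<and>
     F\<^sub>0 (map (\<lambda>i. enc (u ! i) (v ! i) (fst (prod_decode (d ! i)))) [0..<length u])
        (map (\<lambda>i. snd (prod_decode (d ! i))) [0..<length u])" for u v d
  interpret word_coding F by standard (auto simp: F_def)
  have F_restr: "F (restr n \<sigma>) (restr n \<tau>) (restr n \<delta>) \<longleftrightarrow>
     F\<^sub>0 (restr n (\<lambda>i. enc (\<sigma> i) (\<tau> i) (fst (prod_decode (\<delta> i))))) (restr n (\<lambda>i. snd (prod_decode (\<delta> i))))" for n \<sigma> \<tau> \<delta>
  proof -
    have "map (\<lambda>i. enc (restr n \<sigma> ! i) (restr n \<tau> ! i) (fst (prod_decode (restr n \<delta> ! i)))) [0..<n] =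
        restr n (\<lambda>i. enc (\<sigma> i) (\<tau> i) (fst (prod_decode (\<delta> i))))"
      and "map (\<lambda>i. snd (prod_decode (restr n \<delta> ! i))) [0..<n] = restr n (\<lambda>i. snd (prod_decode (\<delta> i)))"
      by (auto intro!: nth_equalityI)
    then show ?thesis by (simp add: F_def)
  qed
  have "rel \<sigma> \<tau> \<longleftrightarrow> \<sigma> \<in> K \<and> \<tau> \<in> K \<and> (r \<sigma>, r \<tau>) \<in> R" for \<sigma> \<tau>
  proof -
    have "rel \<sigma> \<tau> \<longleftrightarrow> (\<exists>\<beta> \<alpha>. \<forall>n. F\<^sub>0 (restr n (\<lambda>i. enc (\<sigma> i) (\<tau> i) (\<beta> i))) (restr n \<alpha>))"
    proof
      assume "rel \<sigma> \<tau>"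
      then obtain \<delta> where "\<forall>n. F (restr n \<sigma>) (restr n \<tau>) (restr n \<delta>)" unfolding rel_def by blast
      then show "\<exists>\<beta> \<alpha>. \<forall>n. F\<^sub>0 (restr n (\<lambda>i. enc (\<sigma> i) (\<tau> i) (\<beta> i))) (restr n \<alpha>)"
        unfolding F_restr by (intro exI)
    next
      assume "\<exists>\<beta> \<alpha>. \<forall>n. F\<^sub>0 (restr n (\<lambda>i. enc (\<sigma> i) (\<tau> i) (\<beta> i))) (restr n \<alpha>)"
      then obtain \<beta> \<alpha> where "\<forall>n. F\<^sub>0 (restr n (\<lambda>i. enc (\<sigma> i) (\<tau> i) (\<beta> i))) (restr n \<alpha>)" by blast
      then show "rel \<sigma> \<tau>"
        unfolding rel_def F_restr by (intro exI[of _ "\<lambda>i. prod_encode (\<beta> i, \<alpha> i)"]) simp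
    qed
    also have "\<dots> \<longleftrightarrow> (\<exists>\<beta>. ((r \<sigma>, r \<tau>), \<beta>) \<in> C \<and> \<sigma> \<in> K \<and> \<tau> \<in> K)"
      unfolding F0[symmetric] dec by (simp add: \<Omega>_def dec)
    also have "\<dots> \<longleftrightarrow> \<sigma> \<in> K \<and> \<tau> \<in> K \<and> (r \<sigma>, r \<tau>) \<in> R"
      unfolding C(2) by force
    finally show ?thesis .
  qed
  then show thesis using that[OF c] word_coding_axioms unfolding K_def by blast
qed

subsection \<open>Isomorphism and embeddability\<close>

lemma quandle_iso_refl: "quandle_iso f f"
  unfolding quandle_iso_def quandle_hom_def using bij_id by (metis id_apply)

lemma quandle_iso_sym:
  assumes "quandle_iso f g" shows "quandle_iso g f"
proof -
  obtain h where h: "bij h" "\<And>x y. h (f x y) = g (h x) (h y)"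
    using assms by (auto simp: quandle_iso_def quandle_hom_def)
  have "inv h (g x y) = f (inv h x) (inv h y)" for x y
    using h by (metis bij_inv_eq_iff)
  then show ?thesis
    unfolding quandle_iso_def quandle_hom_def using bij_imp_bij_inv[OF h(1)] by blast
qed

lemma quandle_iso_trans:
  assumes "quandle_iso f g" and "quandle_iso g k" shows "quandle_iso f k"
proof -
  obtain h h' where "bij h" "quandle_hom f g h" "bij h'" "quandle_hom g k h'"
    using assms by (auto simp: quandle_iso_def)
  then have "bij (h' \<circ> h)" "quandle_hom f k (h' \<circ> h)"
    by (auto simp: quandle_hom_def bij_comp)
  then show ?thesis unfolding quandle_iso_def by blast
qed

lemma quandle_embeds_trans:
  assumes "quandle_embeds f g" and "quandle_embeds g k" shows "quandle_embeds f k"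
proof -
  obtain h h' where "inj h" "quandle_hom f g h" "inj h'" "quandle_hom g k h'"
    using assms by (auto simp: quandle_embeds_def)
  then have "inj (h' \<circ> h)" "quandle_hom f k (h' \<circ> h)"
    by (auto simp: quandle_hom_def inj_compose)
  then show ?thesis unfolding quandle_embeds_def by blast
qed

lemma quandle_iso_embeds: "quandle_iso f g \<Longrightarrow> quandle_embeds f g"
  unfolding quandle_iso_def quandle_embeds_def using bij_is_inj by blast

lemma quandle_embeds_cong:
  assumes "quandle_iso f g" and "quandle_iso f' g'"
  shows "quandle_embeds f f' \<longleftrightarrow> quandle_embeds g g'"
  using assms by (meson quandle_embeds_trans quandle_iso_embeds quandle_iso_sym)

lemma quandle_of_iso:
  assumes "quandle f" and "quandle_iso f g" shows "quandle g"
proof -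
  obtain h where h: "bij h" "\<And>x y. g (h x) (h y) = h (f x y)"
    using assms(2) by (auto simp: quandle_iso_def quandle_hom_def)
  note inj = inj_eq[OF bij_is_inj[OF h(1)]]
  have f: "f a (f b c) = f (f a b) (f a c)" "\<exists>!b. f a b = c" "f a a = a" for a b c
    using assms(1) unfolding quandle_def by blast+
  have "g x (g y z) = g (g x y) (g x z) \<and> (\<exists>!y. g x y = z) \<and> g x x = x" for x y z
  proof -
    obtain a b c where x: "x = h a" "y = h b" "z = h c" using h(1) by (metis bij_pointE)
    obtain b' where b': "f a b' = c" "\<And>b. f a b = c \<Longrightarrow> b = b'" using f(2)[of a c] by blast
    have "\<exists>!y. g x y = z"
    proof
      show "g x (h b') = z" by (simp add: x h b')
      show "y = h b'" if "g x y = z" for y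
        using that h(1) b'(2) by (metis bij_pointE h(2) inj x(1,3))
    qed
    then show ?thesis by (simp add: x h f(1,3)[symmetric]) (simp add: f)
  qed
  then show ?thesis unfolding quandle_def by blast
qed

subsection \<open>The space of quandles\<close>

text \<open>Inverts \<open>op_graph\<close>; the \<open>LEAST\<close> over numbers keeps it
  measurable in the graph.\<close>

definition opof :: "(nat \<times> nat \<times> nat \<Rightarrow> bool) \<Rightarrow> nat \<Rightarrow> nat \<Rightarrow> nat" where
  "opof G x y = (LEAST z. G (x, y, z))"

lemma opof_op_graph [simp]: "opof (op_graph g) = g"
  by (auto simp: opof_def op_graph_def fun_eq_iff intro: Least_equality)

lemma space_Qdl: "space Qdl_space = X_Qdl"
  by (simp add: Qdl_space_def space_restrict_space)

text \<open>In terms of the graph every axiom becomes a countable conjunction of open conditions,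
  which makes \<open>X_Qdl\<close> a G-delta set.\<close>

lemma X_Qdl_iff:
  "G \<in> X_Qdl \<longleftrightarrow>
    (\<forall>x y. \<exists>z. G (x, y, z)) \<and>
    (\<forall>x y z z'. G (x, y, z) \<longrightarrow> G (x, y, z') \<longrightarrow> z = z') \<and>
    (\<forall>x y z a b c d. G (y, z, a) \<longrightarrow> G (x, a, b) \<longrightarrow> G (x, y, c) \<longrightarrow> G (x, z, d) \<longrightarrow> G (c, d, b)) \<and>
    (\<forall>x z. \<exists>y. G (x, y, z)) \<and>
    (\<forall>x y y' z. G (x, y, z) \<longrightarrow> G (x, y', z) \<longrightarrow> y = y') \<and>
    (\<forall>x. G (x, x, x))" (is "_ \<longleftrightarrow> ?P")
proof
  assume "G \<in> X_Qdl"
  then obtain s where G: "G = op_graph s" and s: "quandle s" by (auto simp: X_Qdl_def)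
  from s show ?P
    unfolding quandle_def G op_graph_def by (simp; metis)
next
  assume P: ?P
  then obtain s where s: "\<And>x y. G (x, y, s x y)" by metis
  with P have G: "G (x, y, z) \<longleftrightarrow> s x y = z" for x y z by metis
  have "quandle s"
    using P unfolding quandle_def G by metis
  moreover have "G = op_graph s" by (auto simp: op_graph_def fun_eq_iff G)
  ultimately show "G \<in> X_Qdl" unfolding X_Qdl_def by blast
qed

lemma open_coordinate: "open {G :: 'i \<Rightarrow> bool. G p}"
  using open_vimage[OF open_discrete[of "{True}"] continuous_on_product_coordinates[of p]]
  by (simp add: vimage_def)

lemma open_not_coordinate: "open {G :: 'i \<Rightarrow> bool. \<not> G p}"
  using open_vimage[OF open_discrete[of "{False}"] continuous_on_product_coordinates[of p]]
  by (simp add: vimage_def)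

lemma gdelta_in_Collect_all:
  assumes "\<And>i :: 'i :: countable. gdelta_in T {G. P i G}"
  shows "gdelta_in T {G. \<forall>i. P i G}"
proof -
  have "gdelta_in T (\<Inter> (range (\<lambda>i. {G. P i G})))"
    using assms by (intro gdelta_in_Inter) auto
  then show ?thesis by (simp add: INTER_eq)
qed

lemma gdelta_in_Collect_conj:
  "gdelta_in T {G. P G} \<Longrightarrow> gdelta_in T {G. Q G} \<Longrightarrow> gdelta_in T {G. P G \<and> Q G}"
  using gdelta_in_Int[of T "{G. P G}" "{G. Q G}"] by (simp add: Collect_conj_eq)

lemma gdelta_in_X_Qdl: "gdelta_in euclidean X_Qdl"
proof -
  have open_imp: "open {G. G p \<longrightarrow> Q G}" if "open {G. Q G}"
    for p and Q :: "(nat \<times> nat \<times> nat \<Rightarrow> bool) \<Rightarrow> bool"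
    using open_Collect_disj[OF open_not_coordinate[of p] that] by (simp only: imp_conv_disj)
  have "open {G. \<exists>z. G (x, y, z)}" "open {G. \<exists>y. G (x, y, z)}"
      "open {G :: nat \<times> nat \<times> nat \<Rightarrow> bool. G (x, x, x)}"
      "open {G. G (x, y, z) \<longrightarrow> G (x, y, z') \<longrightarrow> z = z'}"
      "open {G. G (x, y, z) \<longrightarrow> G (x, y', z) \<longrightarrow> y = y'}"
      "open {G. G (y, z, a) \<longrightarrow> G (x, a, b) \<longrightarrow> G (x, y, c) \<longrightarrow> G (x, z, d) \<longrightarrow> G (c, d, b)}"
    for x y z y' z' a b c d :: nat
    by (rule open_Collect_ex open_coordinate open_imp open_Collect_const)+
  note op = this[THEN open_openin[THEN iffD1], THEN open_imp_gdelta_in]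
  have "X_Qdl = {G. G \<in> X_Qdl}" by simp
  also have "gdelta_in euclidean \<dots>"
    unfolding X_Qdl_iff
    by (rule gdelta_in_Collect_conj op | rule gdelta_in_Collect_all)+
  finally show ?thesis .
qed

lemma standard_borel_Qdl: "standard_borel Qdl_space"
proof -
  let ?E = "euclidean :: (nat \<times> nat \<times> nat \<Rightarrow> bool) topology"
  have "(euclidean :: bool topology) = discrete_topology UNIV"
    by (simp add: topology_eq open_discrete)
  then have "completely_metrizable_space ?E"
    unfolding euclidean_product_topology[symmetric] completely_metrizable_space_product_topology
    by (simp add: completely_metrizable_space_discrete_topology)
  then have "completely_metrizable_space (subtopology ?E X_Qdl)"
    using gdelta_in_X_Qdl by (rule completely_metrizable_space_gdelta_in)
  moreover have "second_countable ?E"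
  proof -
    obtain \<B> :: "(nat \<times> nat \<times> nat \<Rightarrow> bool) set set" where "countable \<B>" "topological_basis \<B>"
      using ex_countable_basis by blast
    then show ?thesis
      unfolding second_countable_def by (metis open_openin topological_basisE topological_basis_open)
  qed
  then have "second_countable (subtopology ?E X_Qdl)"
    by (rule second_countable_subtopology)
  moreover have "sets Qdl_space = sigma_sets X_Qdl {U. openin (subtopology ?E X_Qdl) U}"
  proof -
    have X: "X_Qdl \<in> sigma_sets UNIV {U. open U}"
    proof -
      have "X_Qdl = {G\<in>space borel. G \<in> X_Qdl}" by simp
      also have "\<dots> \<in> sets borel" unfolding X_Qdl_iff by measurable
      finally show ?thesis by (simp add: borel_def)
    qed
    have "sets Qdl_space = (\<inter>) X_Qdl ` sigma_sets UNIV {U. open U}"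
      by (simp add: Qdl_space_def sets_restrict_space borel_def)
    also have "\<dots> = sigma_sets X_Qdl ((\<inter>) X_Qdl ` {U. open U})"
      using sigma_sets_Int[OF X] by simp
    also have "(\<inter>) X_Qdl ` {U. open U} = {U. openin (subtopology ?E X_Qdl) U}"
      by (auto simp: openin_subtopology Int_commute)
    finally show ?thesis .
  qed
  ultimately show ?thesis
    unfolding standard_borel_def by (intro exI[of _ "subtopology ?E X_Qdl"]) (auto simp: space_Qdl)
qed

lemma measurable_Qdl_coordinate [measurable]: "Measurable.pred Qdl_space (\<lambda>G. G p)"
  unfolding Qdl_space_def by (rule measurable_restrict_space1) measurable

lemma analytic_quasi_order_Qdl: "analytic_quasi_order Qdl_space Qdl_emb"
proof -
  have "quandle_embeds s s" for s :: "nat \<Rightarrow> nat \<Rightarrow> nat"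
    using quandle_iso_embeds quandle_iso_refl by blast
  then have "preorder_on (space Qdl_space) Qdl_emb"
    unfolding preorder_on_def refl_on_def trans_def space_Qdl X_Qdl_def Qdl_emb_def
    by (auto simp: inj_eq[OF inj_op_graph]) (metis quandle_embeds_trans)
  moreover have "analytic_set (Qdl_space \<Otimes>\<^sub>M Qdl_space) Qdl_emb"
    unfolding analytic_set_def
  proof (rule bexI)
    let ?N = "(Qdl_space \<Otimes>\<^sub>M Qdl_space) \<Otimes>\<^sub>M (borel :: (nat \<Rightarrow> nat) measure)"
    \<comment> \<open>The embedding itself is the Baire space witness. Naming its values
      \<open>a\<close>, \<open>b\<close>, \<open>c\<close> by countable quantifiers leaves only
      evaluations of the second graph at fixed triples.\<close>
    let ?C = "{w \<in> space ?N. (\<forall>x y. snd w x = snd w y \<longrightarrow> x = y) \<and>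
       (\<forall>x y z. fst (fst w) (x, y, z) \<longrightarrow>
          (\<exists>a b c. snd w x = a \<and> snd w y = b \<and> snd w z = c \<and> snd (fst w) (a, b, c)))}"
    have h [measurable]: "(\<lambda>w. snd w x) \<in> ?N \<rightarrow>\<^sub>M count_space UNIV" for x
      unfolding measurable_borel_countable[symmetric]
      by (rule measurable_compose[OF measurable_snd measurable_product_coordinates])
    have [measurable]: "Measurable.pred ?N (\<lambda>w. fst (fst w) p)" "Measurable.pred ?N (\<lambda>w. snd (fst w) p)" for p
      by (rule measurable_compose[OF _ measurable_Qdl_coordinate], measurable)+
    show "?C \<in> sets ?N" by measurable
    have "(G, G') \<in> Qdl_emb \<longleftrightarrow> (\<exists>h. ((G, G'), h) \<in> ?C)" for G G'
    proof
      assume "(G, G') \<in> Qdl_emb"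
      then obtain s t h where "G = op_graph s" "G' = op_graph t" "quandle s" "quandle t"
          "inj h" "quandle_hom s t h"
        by (auto simp: Qdl_emb_def quandle_embeds_def)
      then have "((G, G'), h) \<in> ?C"
        by (auto simp: space_pair_measure space_Qdl X_Qdl_def op_graph_def quandle_hom_def inj_def)
      then show "\<exists>h. ((G, G'), h) \<in> ?C" by blast
    next
      assume "\<exists>h. ((G, G'), h) \<in> ?C"
      then obtain h where h: "((G, G'), h) \<in> ?C" by blast
      then obtain s t where st: "G = op_graph s" "G' = op_graph t" "quandle s" "quandle t"
        by (auto simp: space_pair_measure space_Qdl X_Qdl_def)
      have "inj h" "quandle_hom s t h"
        using h by (auto simp: st op_graph_def quandle_hom_def inj_def)
      then show "(G, G') \<in> Qdl_emb"
        using st by (auto simp: Qdl_emb_def quandle_embeds_def)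
    qed
    then show "Qdl_emb = fst ` ?C" by (auto simp: image_iff)
  qed
  ultimately show ?thesis by (simp add: analytic_quasi_order_def)
qed

subsection \<open>Measurability of the presentation\<close>

text \<open>The arguments take countably many values, so constant arguments suffice.\<close>

lemma measurable_opof [measurable (raw)]:
  assumes [measurable]: "f \<in> M \<rightarrow>\<^sub>M count_space UNIV" "h \<in> M \<rightarrow>\<^sub>M count_space UNIV"
    and G: "G \<in> M \<rightarrow>\<^sub>M Qdl_space"
  shows "(\<lambda>x. opof (G x) (f x) (h x)) \<in> M \<rightarrow>\<^sub>M count_space UNIV"
proof -
  have [measurable]: "(\<lambda>x. opof (G x) a b) \<in> M \<rightarrow>\<^sub>M count_space UNIV" for a b
    unfolding opof_def by (rule measurable_compose[OF G]) measurable
  have "(\<lambda>x. opof (G x) a (h x)) \<in> M \<rightarrow>\<^sub>M count_space UNIV" for a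
    by (rule measurable_compose_countable[where f="\<lambda>b x. opof (G x) a b"]) measurable
  then show ?thesis
    by (rule measurable_compose_countable[where f="\<lambda>a x. opof (G x) a (h x)"]) measurable
qed

lemma measurable_funpow_opof [measurable]:
  "(\<lambda>G. (opof G c ^^ k) y) \<in> Qdl_space \<rightarrow>\<^sub>M count_space UNIV"
  by (induction k) simp_all

lemma measurable_hubs [measurable]: "Measurable.pred Qdl_space (\<lambda>G. hubs (opof G) c)"
  unfolding hubs_def by measurable

lemma measurable_flips [measurable]: "Measurable.pred Qdl_space (\<lambda>G. flips (opof G) p)"
  unfolding flips_def by measurable

lemma measurable_moves [measurable]: "Measurable.pred Qdl_space (\<lambda>G. moves (opof G) k a y)"
  unfolding moves_def by measurable

lemma measurable_origin [measurable]: "Measurable.pred Qdl_space (\<lambda>G. origin (opof G) n y)"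
  unfolding origin_def by measurable

lemma measurable_fibre [measurable]: "Measurable.pred Qdl_space (\<lambda>G. fibre (opof G) v y)"
  unfolding fibre_def by measurable

lemma measurable_actor [measurable]: "Measurable.pred Qdl_space (\<lambda>G. actor (opof G) v k a)"
  unfolding actor_def by measurable

lemma measurable_inert [measurable]: "Measurable.pred Qdl_space (\<lambda>G. inert (opof G) y)"
  unfolding inert_def by measurable

lemma measurable_decode [measurable]: "(\<lambda>G. decode (opof G)) \<in> Qdl_space \<rightarrow>\<^sub>M borel"
  by (rule measurable_bool_functionI, unfold decode_def) measurable

lemma measurable_shifted [measurable]: "Measurable.pred Qdl_space (\<lambda>G. shifted (opof G) j z y)"
  unfolding shifted_def by measurable

lemma measurable_pick [measurable]: "(\<lambda>G. pick (opof G) e) \<in> Qdl_space \<rightarrow>\<^sub>M count_space UNIV"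
proof (cases e)
  case (Fib v j)
  have "(\<lambda>G. LEAST y. shifted (opof G) j (LEAST z. fibre (opof G) v z) y) \<in> Qdl_space \<rightarrow>\<^sub>M count_space UNIV"
    \<comment> \<open>The base point varies with the operation, but over a countable set, so it may
      be treated as a constant.\<close>
    by (rule measurable_compose_countable[where f="\<lambda>z G. LEAST y. shifted (opof G) j z y"]) measurable
  then show ?thesis by (simp add: Fib)
qed (simp_all add: Let_def)

section \<open>Measurability in the code, the Borel class of copies and the two reductions\<close>

context word_coding
begin

lemma measurable_labelled [measurable]: "Measurable.pred borel (\<lambda>\<sigma>. labelled \<sigma> v u)"
proof -
  have eq: "restr n \<sigma> = w \<longleftrightarrow> length w = n \<and> (\<forall>i<n. w ! i = \<sigma> i)" for n \<sigma> and w :: "bool list"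
    by (auto simp: list_eq_iff_nth_eq)
  have "labelled \<sigma> v u \<longleftrightarrow>
     (\<exists>w. length u = fst v \<and> length w = fst v \<and> (\<forall>i<fst v. w ! i = \<sigma> i) \<and> chain u (snd v) w)" for \<sigma>
    unfolding labelled_def using eq by metis
  then show ?thesis by simp
qed

lemma measurable_live [measurable]: "Measurable.pred borel (\<lambda>\<sigma>. live \<sigma> e)"
  by (cases e) simp_all

lemma measurable_weight [measurable]: "(\<lambda>\<sigma>. weight \<sigma> a v) \<in> borel \<rightarrow>\<^sub>M count_space UNIV"
proof (cases a)
  case (Act w)
  then show ?thesis by (cases w; cases v) simp
qed simp_all

lemma measurable_qop [measurable]: "(\<lambda>\<sigma>. qop \<sigma> a e) \<in> borel \<rightarrow>\<^sub>M count_space UNIV"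
proof (cases e)
  case (Fib v j)
  show ?thesis unfolding Fib qop_simps
    by (rule measurable_compose[OF measurable_weight]) simp
qed simp_all

lemma measurable_copies [measurable]:
  "Measurable.pred Qdl_space (\<lambda>G. copies (decode (opof G)) (opof G))"
proof -
  have [measurable]: "(\<lambda>G. pick (opof G) (qop (decode (opof G)) e e')) \<in> Qdl_space \<rightarrow>\<^sub>M count_space UNIV" for e e'
    by (rule measurable_compose_countable[where f="\<lambda>e G. pick (opof G) e"])
      (auto intro: measurable_compose[OF measurable_decode measurable_qop])
  have [measurable]: "Measurable.pred Qdl_space (\<lambda>G. live (decode (opof G)) e)" for e
    by (rule measurable_compose[OF measurable_decode measurable_live])
  show ?thesis unfolding copies_def by measurable
qed

text \<open>All word quandles share the carrier \<open>elem\<close>, so one enumeration serves every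
  \<sigma> and the result depends measurably on \<sigma>.\<close>

definition natop :: "(nat \<Rightarrow> bool) \<Rightarrow> nat \<Rightarrow> nat \<Rightarrow> nat" where
  "natop \<sigma> m n = to_nat_on UNIV (qop \<sigma> (from_nat_into UNIV m) (from_nat_into UNIV n))"

lemma infinite_elem: "infinite (UNIV :: elem set)"
  by (rule infinite_super[OF subset_UNIV infinite_not_live])

lemma iso_natop: "quandle_iso (qop \<sigma>) (natop \<sigma>)"
proof -
  have "bij (to_nat_on (UNIV :: elem set))"
    using to_nat_on_infinite[OF _ infinite_elem] by simp
  moreover have "quandle_hom (qop \<sigma>) (natop \<sigma>) (to_nat_on UNIV)"
    by (simp add: quandle_hom_def natop_def)
  ultimately show ?thesis unfolding quandle_iso_def by blast
qed

lemma measurable_natop: "(\<lambda>\<sigma>. op_graph (natop \<sigma>)) \<in> borel \<rightarrow>\<^sub>M Qdl_space"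
  unfolding Qdl_space_def
proof (rule measurable_restrict_space2)
  show "(\<lambda>\<sigma>. op_graph (natop \<sigma>)) \<in> space borel \<rightarrow> X_Qdl"
    using quandle_of_iso[OF quandle_qop iso_natop] by (auto simp: X_Qdl_def)
  show "(\<lambda>\<sigma>. op_graph (natop \<sigma>)) \<in> borel_measurable borel"
  proof (rule measurable_bool_functionI)
    fix i :: "nat \<times> nat \<times> nat"
    obtain x y z where i: "i = (x, y, z)" by (cases i)
    have [measurable]: "(\<lambda>\<sigma>. natop \<sigma> x y) \<in> borel \<rightarrow>\<^sub>M count_space UNIV"
      unfolding natop_def by (rule measurable_compose[OF measurable_qop]) simp
    show "Measurable.pred borel (\<lambda>\<sigma>. op_graph (natop \<sigma>) i)"
      unfolding i op_graph_def prod.case by measurable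
  qed
qed

lemma decode_of_iso:
  assumes "quandle_iso (qop \<sigma>) g" shows "decode g = \<sigma>"
  using assms transport_decode decode_qop unfolding quandle_iso_def by metis

text \<open>A copy determines its code through \<open>decode\<close>, so the quantifier over all
  codes reduces to one Borel test.\<close>

lemma copies_decode_iff:
  "copies (decode g) g \<longleftrightarrow> (\<exists>\<sigma>. quandle_iso (qop \<sigma>) g)"
  using copies_of_iso decode_of_iso iso_of_copies by metis

lemma invariantly_universal:
  fixes M :: "'a measure"
  assumes R: "preorder_on (space M) R"
    and c: "c \<in> M \<rightarrow>\<^sub>M borel" "c ` space M \<in> sets borel"
    and r: "r \<in> restrict_space borel (c ` space M) \<rightarrow>\<^sub>M M" and rc: "\<And>x. x \<in> space M \<Longrightarrow> r (c x) = x"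
    and rel: "\<And>\<sigma> \<tau>. rel \<sigma> \<tau> \<longleftrightarrow> \<sigma> \<in> c ` space M \<and> \<tau> \<in> c ` space M \<and> (r \<sigma>, r \<tau>) \<in> R"
  shows "\<exists>B \<in> sets Qdl_space. (\<forall>G\<in>B. \<forall>G'. (G, G') \<in> Qdl_iso \<longrightarrow> G' \<in> B) \<and>
     borel_bireducible (restrict_space Qdl_space B) (Qdl_emb \<inter> B \<times> B) M R"
proof -
  define K where "K = c ` space M"
  have K: "K \<in> sets borel" and r: "r \<in> restrict_space borel K \<rightarrow>\<^sub>M M"
    and rel: "rel \<sigma> \<tau> \<longleftrightarrow> \<sigma> \<in> K \<and> \<tau> \<in> K \<and> (r \<sigma>, r \<tau>) \<in> R" for \<sigma> \<tau>
    using c r rel by (simp_all add: K_def)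
  have rK: "r \<sigma> \<in> space M" if "\<sigma> \<in> K" for \<sigma> using that rc by (auto simp: K_def)
  have Rrefl: "(x, x) \<in> R" if "x \<in> space M" for x
    using R that by (auto simp: preorder_on_def refl_on_def)
  have embeds_iff: "quandle_embeds (qop \<sigma>) (qop \<tau>) \<longleftrightarrow> (r \<sigma>, r \<tau>) \<in> R" if "\<sigma> \<in> K" "\<tau> \<in> K" for \<sigma> \<tau>
  proof
    assume "quandle_embeds (qop \<sigma>) (qop \<tau>)"
    then have "rel\<^sup>*\<^sup>* \<sigma> \<tau>" by (rule rtrancl_rel_of_embeds)
    \<comment> \<open>Zero steps of \<open>rel\<close> are covered by reflexivity of
      \<open>R\<close>, further ones by transitivity.\<close>
    then show "(r \<sigma>, r \<tau>) \<in> R"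
    proof induction
      case base
      show ?case using Rrefl rK that by blast
    next
      case (step y z)
      then show ?case using R rel by (auto simp: preorder_on_def dest: transD)
    qed
  next
    assume "(r \<sigma>, r \<tau>) \<in> R"
    then show "quandle_embeds (qop \<sigma>) (qop \<tau>)"
      using that rel by (intro embeds_of_rel) blast
  qed
  \<comment> \<open>By \<open>copies_decode_iff\<close> these are the copies of
    \<open>qop \<sigma>\<close> for \<sigma> in \<open>K\<close>, an isomorphism-invariant class
    given by a Borel test.\<close>
  define B where "B = {G \<in> space Qdl_space. decode (opof G) \<in> K \<and> copies (decode (opof G)) (opof G)}"
  have B_sets: "B \<in> sets Qdl_space"
    unfolding B_def using K by measurable
  have B_iff: "op_graph g \<in> B \<longleftrightarrow> quandle g \<and> (\<exists>\<sigma>\<in>K. quandle_iso (qop \<sigma>) g)" for g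
    using inj_op_graph copies_decode_iff[of g] decode_of_iso[of _ g]
    by (auto simp: B_def space_Qdl X_Qdl_def inj_eq)
  have B_graph: "\<exists>g. G = op_graph g" if "G \<in> B" for G
    using that by (auto simp: B_def space_Qdl X_Qdl_def)
  have B_space: "space (restrict_space Qdl_space B) = B"
    using B_sets by simp
  have emb_iff: "(op_graph g, op_graph g') \<in> Qdl_emb \<longleftrightarrow> quandle_embeds g g'" if "quandle g" "quandle g'" for g g'
    using that inj_op_graph by (auto simp: Qdl_emb_def inj_eq)
  have emb_B: "(op_graph g, op_graph g') \<in> Qdl_emb \<inter> B \<times> B \<longleftrightarrow> (r (decode g), r (decode g')) \<in> R"
    if B: "op_graph g \<in> B" "op_graph g' \<in> B" for g g'
  proof -
    obtain \<sigma> \<tau> where *: "\<sigma> \<in> K" "\<tau> \<in> K" "quandle_iso (qop \<sigma>) g" "quandle_iso (qop \<tau>) g'"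
        "quandle g" "quandle g'"
      using B by (auto simp: B_iff)
    then show ?thesis
      using embeds_iff[of \<sigma> \<tau>] quandle_embeds_cong[of "qop \<sigma>" g "qop \<tau>" g'] B
      by (simp add: emb_iff decode_of_iso)
  qed
  have "G' \<in> B" if GG': "G \<in> B" "(G, G') \<in> Qdl_iso" for G G'
  proof -
    obtain s t where st: "G = op_graph s" "G' = op_graph t" "quandle t" "quandle_iso s t"
      using GG'(2) by (auto simp: Qdl_iso_def)
    then show ?thesis using GG'(1) quandle_iso_trans by (fastforce simp: B_iff)
  qed
  moreover have "borel_reducible (restrict_space Qdl_space B) (Qdl_emb \<inter> B \<times> B) M R"
    unfolding borel_reducible_def
  proof (intro bexI ballI)
    \<comment> \<open>Decoding a copy to its code and the code to a point reduces to
      \<open>R\<close>; the converse reduction takes a point to the quandle of its code.\<close>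
    let ?f = "\<lambda>G. r (decode (opof G))"
    show "?f \<in> restrict_space Qdl_space B \<rightarrow>\<^sub>M M"
    proof (rule measurable_compose[OF _ r], rule measurable_restrict_space2)
      show "(\<lambda>G. decode (opof G)) \<in> space (restrict_space Qdl_space B) \<rightarrow> K"
        unfolding B_space by (auto simp: B_def)
    qed (rule measurable_restrict_space1[OF measurable_decode])
    fix G G' assume "G \<in> space (restrict_space Qdl_space B)" "G' \<in> space (restrict_space Qdl_space B)"
    then have "G \<in> B" "G' \<in> B" by (simp_all only: B_space)
    then show "(G, G') \<in> Qdl_emb \<inter> B \<times> B \<longleftrightarrow> (?f G, ?f G') \<in> R"
      using B_graph emb_B by (metis opof_op_graph)
  qed
  moreover have "borel_reducible M R (restrict_space Qdl_space B) (Qdl_emb \<inter> B \<times> B)"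
    unfolding borel_reducible_def
  proof (intro bexI ballI)
    let ?f = "\<lambda>x. op_graph (natop (c x))"
    have fB: "?f x \<in> B" if "x \<in> space M" for x
      using that iso_natop quandle_of_iso[OF quandle_qop iso_natop] by (auto simp: B_iff K_def)
    show "?f \<in> M \<rightarrow>\<^sub>M restrict_space Qdl_space B"
      using fB by (intro measurable_restrict_space2 measurable_compose[OF c(1) measurable_natop]) auto
    fix x y assume "x \<in> space M" "y \<in> space M"
    then show "(x, y) \<in> R \<longleftrightarrow> (?f x, ?f y) \<in> Qdl_emb \<inter> B \<times> B"
      using emb_B[OF fB fB] decode_of_iso[OF iso_natop] rc by simp
  qed
  ultimately show ?thesis
    using B_sets unfolding borel_bireducible_def by blast
qed

end

theorem theorem4p5:
  shows "standard_borel Qdl_space \<and>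
    analytic_quasi_order Qdl_space Qdl_emb \<and>
    (\<forall>(M :: 'a measure) R. standard_borel M \<and> analytic_quasi_order M R \<longrightarrow>
      (\<exists>B \<in> sets Qdl_space.
         (\<forall>G\<in>B. \<forall>G'. (G, G') \<in> Qdl_iso \<longrightarrow> G' \<in> B) \<and>
         borel_bireducible (restrict_space Qdl_space B) (Qdl_emb \<inter> B \<times> B) M R))"
proof (intro conjI allI impI standard_borel_Qdl analytic_quasi_order_Qdl)
  fix M :: "'a measure" and R
  assume M: "standard_borel M \<and> analytic_quasi_order M R"
  then have R: "preorder_on (space M) R" "analytic_set (M \<Otimes>\<^sub>M M) R"
    by (auto simp: analytic_quasi_order_def)
  obtain c :: "'a \<Rightarrow> nat \<Rightarrow> bool" and r F where
    c: "c \<in> M \<rightarrow>\<^sub>M borel" "c ` space M \<in> sets borel"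
      "r \<in> restrict_space borel (c ` space M) \<rightarrow>\<^sub>M M" "\<And>x. x \<in> space M \<Longrightarrow> r (c x) = x"
    and F: "word_coding F"
      "\<And>\<sigma> \<tau>. word_coding.rel F \<sigma> \<tau> \<longleftrightarrow> \<sigma> \<in> c ` space M \<and> \<tau> \<in> c ` space M \<and> (r \<sigma>, r \<tau>) \<in> R"
    by (rule analytic_coding[OF conjunct1[OF M] R(2)]) (rule that; assumption)
  show "\<exists>B \<in> sets Qdl_space. (\<forall>G\<in>B. \<forall>G'. (G, G') \<in> Qdl_iso \<longrightarrow> G' \<in> B) \<and>
      borel_bireducible (restrict_space Qdl_space B) (Qdl_emb \<inter> B \<times> B) M R"
    by (rule word_coding.invariantly_universal[OF F(1) R(1) c F(2)])
qed

end
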